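(* Let $\mathcal A$ be the global attractor of the lattice system $\frac{du}{dt}=Fu$ in $\ell^2$, and for $\epsilon\in(0,\epsilon^*]$ let $\mathcal A^\epsilon$ be the numerical attractor of the implicit Euler scheme $u_n^\epsilon=u_{n-1}^\epsilon+\epsilon Fu_n^\epsilon$. Then: (i) $\displaystyle\lim_{\epsilon\to0^+}d_{\ell^2}(\mathcal A^\epsilon,\mathcal A)=0$; (ii) $\epsilon\mapsto\mathcal A^\epsilon$ is upper semi-continuous on $(0,\epsilon^*]$, that is, $\displaystyle\lim_{\epsilon\to\epsilon_0}d_{\ell^2}(\mathcal A^\epsilon,\mathcal A^{\epsilon_0})=0$ for every $\epsilon_0\in(0,\epsilon^*]$.
   Context: $\ell^2$ is the Hilbert space of real square-summable sequences $u=(u_i)_{i\in\mathbb Z}$ with norm $\|u\|=(\sum_i u_i^2)^{1/2}$; $B_r=\{u\in\ell^2:\|u\|\le r\}$. Parameters: $\alpha,\beta,\nu,\lambda>0$, $\gamma\in(0,1)$, $f\in\ell^2$. Operators: $(\Lambda u)_i=-u_{i-1}+2u_i-u_{i+1}$, $(D^-u)_i=u_{i-1}-u_i$. Products of sequences are componentwise. The vector field is $Fu=\nu\Lambda u-\alpha uD^-u+\beta u(1-u)(u-\gamma)-\lambda u+f$. Constants: $\lambda^*=4\nu+\frac{(2\alpha+\beta+\beta\gamma)^2}{4\beta}-\beta\gamma$, with standing assumption $\lambda>\lambda^*$; for $r>0$, $M_r=\beta r^3+(2\alpha+\beta+\beta\gamma)r^2+(4\nu+\beta\gamma+\lambda)r+\|f\|$,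 $L_r=4\nu+2\sqrt5\,r\alpha+\sqrt{12r^2(1+\gamma)^2+27r^4+3\gamma^2}\,\beta+\lambda$; $r^*=1+\frac{\|f\|}{\lambda-\lambda^*}$; $\epsilon^*=\min\left(\frac1{M_{r^*+1}},\frac1{1+L_{r^*+1}}\right)$. The Hausdorff semi-distance is $d_{\ell^2}(A,B)=\sup_{a\in A}\inf_{b\in B}\|a-b\|$. For $u_0\in\ell^2$, $u(t,u_0)$ is the unique solution in $C([0,\infty),\ell^2)$ of $\frac{du}{dt}=Fu$, $u(0)=u_0$. The global attractor $\mathcal A$ is the unique compact set in $\ell^2$ with $u(t,\mathcal A)=\mathcal A$ for all $t\ge0$ and $\lim_{t\to\infty}d_{\ell^2}(u(t,B_r),\mathcal A)=0$ for all $r>0$. For $\epsilon\in(0,\epsilon^*]$ and $y\in B_{r^*}$ the scheme with $u_0^\epsilon=y$ has a unique solution $u_n^\epsilon(y)\in B_{r^*}$; set $S_\epsilon(n)y=u_n^\epsilon(y)$. The numerical attractor $\mathcal A^\epsilon$ is the unique compact set (in $B_{r^*}$) with $S_\epsilon(n)\mathcal A^\epsilon=\mathcal A^\epsilon$ for all $n\in\mathbb N$ and $\lim_{n\to\infty}d_{\ell^2}(S_\epsilon(n)B_{r^*},\mathcal A^\epsilon)=0$. *)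

theory Defs
  imports "HOL-Analysis.Analysis"
begin

definition square_summable :: "(int \<Rightarrow> real) \<Rightarrow> bool" where
  "square_summable u \<longleftrightarrow> (\<lambda>i. (u i)\<^sup>2) summable_on UNIV"

lemma square_summable_zero: "square_summable (\<lambda>i. 0)"
  by (simp add: square_summable_def)

lemma square_summable_dominated:
  assumes "(g :: int \<Rightarrow> real) summable_on UNIV" and "\<And>i. (u i)\<^sup>2 \<le> g i"
  shows "square_summable u"
  unfolding square_summable_def
  by (rule summable_on_comparison_test[OF assms(1)]) (use assms(2) in auto)

lemma square_summable_add:
  assumes "square_summable u" "square_summable v"
  shows "square_summable (\<lambda>i. u i + v i)"
proof (rule square_summable_dominated)
  show "(\<lambda>i. 2 * (u i)\<^sup>2 + 2 * (v i)\<^sup>2) summable_on UNIV"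
    using assms unfolding square_summable_def
    by (intro summable_on_add summable_on_cmult_right) auto
  show "(u i + v i)\<^sup>2 \<le> 2 * (u i)\<^sup>2 + 2 * (v i)\<^sup>2" for i
    using zero_le_power2[of "u i - v i"] by (simp add: power2_eq_square algebra_simps)
qed

lemma square_summable_cmult:
  assumes "square_summable u"
  shows "square_summable (\<lambda>i. c * u i)"
  using assms unfolding square_summable_def
  by (simp add: power_mult_distrib summable_on_cmult_right)

lemma square_summable_minus:
  "square_summable u \<Longrightarrow> square_summable (\<lambda>i. - u i)"
  by (simp add: square_summable_def)

lemma square_summable_diff:
  assumes "square_summable u" "square_summable v"
  shows "square_summable (\<lambda>i. u i - v i)"
  using square_summable_add[OF assms(1) square_summable_minus[OF assms(2)]] by simp

lemma square_summable_mult: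
  assumes "square_summable u" "square_summable v"
  shows "square_summable (\<lambda>i. u i * v i)"
proof (rule square_summable_dominated)
  let ?S = "\<Sum>\<^sub>\<infinity>i. (u i)\<^sup>2"
  show "(\<lambda>i. ?S * (v i)\<^sup>2) summable_on UNIV"
    using assms(2) unfolding square_summable_def by (rule summable_on_cmult_right)
  show "(u i * v i)\<^sup>2 \<le> ?S * (v i)\<^sup>2" for i
  proof -
    have "(\<Sum>j\<in>{i}. (u j)\<^sup>2) \<le> ?S"
      using assms(1) unfolding square_summable_def by (rule finite_sum_le_infsum) auto
    then show ?thesis
      by (simp add: power_mult_distrib mult_right_mono)
  qed
qed

lemma square_summable_shift:
  assumes "square_summable u"
  shows "square_summable (\<lambda>i. u (i + k))"
  using assms unfolding square_summable_def
  by (subst summable_on_reindex_bij_betw[where g = "\<lambda>i. i + k" and A = UNIV and B = UNIV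
        and f = "\<lambda>i. (u i)\<^sup>2"]) (auto simp: bij_plus_right)

lemma square_summable_product_summable:
  assumes "square_summable u" "square_summable v"
  shows "(\<lambda>i. u i * v i) summable_on UNIV"
proof -
  have "(\<lambda>i. norm (u i * v i)) summable_on UNIV"
    using assms unfolding square_summable_def
    by - (rule abs_summable_product; simp add: power2_eq_square)
  then show ?thesis by (rule abs_summable_summable)
qed

typedef ell2 = "{u :: int \<Rightarrow> real. square_summable u}"
  morphisms seq_of Abs_ell2
  using square_summable_zero by blast

setup_lifting type_definition_ell2

lemma square_summable_seq_of: "square_summable (seq_of u)"
  using seq_of[of u] by simp

instantiation ell2 :: real_vector
begin

lift_definition zero_ell2 :: ell2 is "\<lambda>i. 0"
  by (rule square_summable_zero)

lift_definition plus_ell2 :: "ell2 \<Rightarrow> ell2 \<Rightarrow> ell2" is "\<lambda>u v i. u i + v i"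
  by (rule square_summable_add)

lift_definition minus_ell2 :: "ell2 \<Rightarrow> ell2 \<Rightarrow> ell2" is "\<lambda>u v i. u i - v i"
  by (rule square_summable_diff)

lift_definition uminus_ell2 :: "ell2 \<Rightarrow> ell2" is "\<lambda>u i. - u i"
  by (rule square_summable_minus)

lift_definition scaleR_ell2 :: "real \<Rightarrow> ell2 \<Rightarrow> ell2" is "\<lambda>c u i. c * u i"
  by (rule square_summable_cmult)

instance
proof
  fix u v w :: ell2 and a b :: real
  show "u + v + w = u + (v + w)" by transfer (simp add: add.assoc)
  show "u + v = v + u" by transfer (simp add: add.commute)
  show "0 + u = u" by transfer simp
  show "- u + u = 0" by transfer simp
  show "u - v = u + - v" by transfer simp
  show "a *\<^sub>R (u + v) = a *\<^sub>R u + a *\<^sub>R v" by transfer (simp add: algebra_simps)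
  show "(a + b) *\<^sub>R u = a *\<^sub>R u + b *\<^sub>R u" by transfer (simp add: algebra_simps)
  show "a *\<^sub>R b *\<^sub>R u = (a * b) *\<^sub>R u" by transfer (simp add: algebra_simps)
  show "1 *\<^sub>R u = u" by transfer simp
qed

end

instantiation ell2 :: real_inner
begin

definition inner_ell2 :: "ell2 \<Rightarrow> ell2 \<Rightarrow> real" where
  "inner_ell2 u v = (\<Sum>\<^sub>\<infinity>i. seq_of u i * seq_of v i)"

definition norm_ell2 :: "ell2 \<Rightarrow> real" where
  "norm_ell2 u = sqrt (\<Sum>\<^sub>\<infinity>i. (seq_of u i)\<^sup>2)"

definition sgn_ell2 :: "ell2 \<Rightarrow> ell2" where
  "sgn_ell2 u = u /\<^sub>R norm u"

definition dist_ell2 :: "ell2 \<Rightarrow> ell2 \<Rightarrow> real" where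
  "dist_ell2 u v = norm (u - v)"

definition uniformity_ell2 :: "(ell2 \<times> ell2) filter" where
  "uniformity_ell2 = (INF e\<in>{0 <..}. principal {(x, y). dist x y < e})"

definition open_ell2 :: "ell2 set \<Rightarrow> bool" where
  "open_ell2 U \<longleftrightarrow> (\<forall>x\<in>U. \<forall>\<^sub>F (x', y) in uniformity. x' = x \<longrightarrow> y \<in> U)"

instance
proof
  fix u v w :: ell2 and a :: real
  show "dist u v = norm (u - v)" by (simp add: dist_ell2_def)
  show "sgn u = u /\<^sub>R norm u" by (simp add: sgn_ell2_def)
  show "uniformity = (INF e\<in>{0 <..}. principal {(x :: ell2, y). dist x y < e})"
    by (simp add: uniformity_ell2_def)
  show "open U \<longleftrightarrow> (\<forall>x\<in>U. \<forall>\<^sub>F (x', y) in uniformity. x' = x \<longrightarrow> y \<in> U)" for U :: "ell2 set"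
    by (simp add: open_ell2_def)
  show "u \<bullet> v = v \<bullet> u" by (simp add: inner_ell2_def mult.commute)
  show "(u + v) \<bullet> w = u \<bullet> w + v \<bullet> w"
    unfolding inner_ell2_def plus_ell2.rep_eq distrib_right
    by (intro infsum_add square_summable_product_summable square_summable_seq_of)
  show "(a *\<^sub>R u) \<bullet> v = a * (u \<bullet> v)"
    unfolding inner_ell2_def scaleR_ell2.rep_eq mult.assoc
    by (rule infsum_cmult_right) (intro square_summable_product_summable square_summable_seq_of)
  show "0 \<le> u \<bullet> u"
    unfolding inner_ell2_def by (rule infsum_nonneg) simp
  show "u \<bullet> u = 0 \<longleftrightarrow> u = 0"
  proof
    assume "u \<bullet> u = 0"
    then have "seq_of u i * seq_of u i = 0" for i
      unfolding inner_ell2_def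
      by (rule nonneg_infsum_le_0D[OF eq_refl])
        (auto intro!: square_summable_product_summable square_summable_seq_of)
    then show "u = 0" by transfer auto
  qed (simp add: inner_ell2_def zero_ell2.rep_eq)
  show "norm u = sqrt (u \<bullet> u)"
    by (simp add: norm_ell2_def inner_ell2_def power2_eq_square)
qed

end

definition Lap :: "(int \<Rightarrow> real) \<Rightarrow> int \<Rightarrow> real" where
  "Lap u i = - u (i - 1) + 2 * u i - u (i + 1)"

definition Dminus :: "(int \<Rightarrow> real) \<Rightarrow> int \<Rightarrow> real" where
  "Dminus u i = u (i - 1) - u i"

lemma square_summable_Lap: "square_summable u \<Longrightarrow> square_summable (Lap u)"
  unfolding Lap_def[abs_def]
  using square_summable_shift[of u "-1"] square_summable_shift[of u 1]
  by (intro square_summable_diff square_summable_add square_summable_minus square_summable_cmult)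
    simp_all

lemma square_summable_Dminus: "square_summable u \<Longrightarrow> square_summable (Dminus u)"
  unfolding Dminus_def[abs_def]
  using square_summable_shift[of u "-1"]
  by (intro square_summable_diff) simp_all

lemma square_summable_cubic:
  assumes "square_summable u"
  shows "square_summable (\<lambda>i. u i * (1 - u i) * (u i - \<gamma>))"
proof -
  have eq: "(\<lambda>i. u i * (1 - u i) * (u i - \<gamma>))
      = (\<lambda>i. (1 + \<gamma>) * (u i * u i) - u i * (u i * u i) - \<gamma> * u i)"
    by (auto simp: algebra_simps)
  show ?thesis
    unfolding eq
    by (intro square_summable_diff square_summable_cmult square_summable_mult assms)
qed

lift_definition vector_field ::
  "real \<Rightarrow> real \<Rightarrow> real \<Rightarrow> real \<Rightarrow> real \<Rightarrow> ell2 \<Rightarrow> ell2 \<Rightarrow> ell2"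
  is "\<lambda>\<alpha> \<beta> \<nu> lam \<gamma> f u i. \<nu> * Lap u i - \<alpha> * (u i * Dminus u i)
        + \<beta> * (u i * (1 - u i) * (u i - \<gamma>)) - lam * u i + f i"
  by (intro square_summable_add square_summable_diff square_summable_cmult square_summable_mult
      square_summable_Lap square_summable_Dminus square_summable_cubic)

definition lambda_star :: "real \<Rightarrow> real \<Rightarrow> real \<Rightarrow> real \<Rightarrow> real" where
  "lambda_star \<alpha> \<beta> \<nu> \<gamma> = 4 * \<nu> + (2 * \<alpha> + \<beta> + \<beta> * \<gamma>)\<^sup>2 / (4 * \<beta>) - \<beta> * \<gamma>"

definition M_const ::
  "real \<Rightarrow> real \<Rightarrow> real \<Rightarrow> real \<Rightarrow> real \<Rightarrow> ell2 \<Rightarrow> real \<Rightarrow> real" where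
  "M_const \<alpha> \<beta> \<nu> lam \<gamma> f r =
     \<beta> * r^3 + (2 * \<alpha> + \<beta> + \<beta> * \<gamma>) * r\<^sup>2 + (4 * \<nu> + \<beta> * \<gamma> + lam) * r + norm f"

definition L_const ::
  "real \<Rightarrow> real \<Rightarrow> real \<Rightarrow> real \<Rightarrow> real \<Rightarrow> real \<Rightarrow> real" where
  "L_const \<alpha> \<beta> \<nu> lam \<gamma> r =
     4 * \<nu> + 2 * sqrt 5 * r * \<alpha>
     + sqrt (12 * r\<^sup>2 * (1 + \<gamma>)\<^sup>2 + 27 * r^4 + 3 * \<gamma>\<^sup>2) * \<beta> + lam"

definition r_star ::
  "real \<Rightarrow> real \<Rightarrow> real \<Rightarrow> real \<Rightarrow> real \<Rightarrow> ell2 \<Rightarrow> real" where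
  "r_star \<alpha> \<beta> \<nu> lam \<gamma> f = 1 + norm f / (lam - lambda_star \<alpha> \<beta> \<nu> \<gamma>)"

definition eps_star ::
  "real \<Rightarrow> real \<Rightarrow> real \<Rightarrow> real \<Rightarrow> real \<Rightarrow> ell2 \<Rightarrow> real" where
  "eps_star \<alpha> \<beta> \<nu> lam \<gamma> f =
     min (1 / M_const \<alpha> \<beta> \<nu> lam \<gamma> f (r_star \<alpha> \<beta> \<nu> lam \<gamma> f + 1))
         (1 / (1 + L_const \<alpha> \<beta> \<nu> lam \<gamma> (r_star \<alpha> \<beta> \<nu> lam \<gamma> f + 1)))"

text \<open>The values are extended nonnegative reals, so that the supremum and the infimum are the
  true ones for arbitrary sets (a nonempty set has infinite semi-distance to the empty set).\<close>

definition hausdorff_semidist :: "ell2 set \<Rightarrow> ell2 set \<Rightarrow> ennreal" where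
  "hausdorff_semidist A B = (SUP a\<in>A. INF b\<in>B. ennreal (norm (a - b)))"

definition is_solution :: "(ell2 \<Rightarrow> ell2) \<Rightarrow> ell2 \<Rightarrow> (real \<Rightarrow> ell2) \<Rightarrow> bool" where
  "is_solution F u0 u \<longleftrightarrow>
     continuous_on {0..} u \<and>
     (\<forall>t\<ge>0. (u has_vector_derivative F (u t)) (at t within {0..})) \<and>
     u 0 = u0"

text \<open>Functions on \<open>[0,\<infinity>)\<close> are represented as extensional functions, which makes the solution
  unique also as a function on all of \<^typ>\<open>real\<close>.\<close>

definition flow :: "(ell2 \<Rightarrow> ell2) \<Rightarrow> real \<Rightarrow> ell2 \<Rightarrow> ell2" where
  "flow F t u0 = (THE u. u \<in> extensional {0..} \<and> is_solution F u0 u) t"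

definition is_global_attractor :: "(ell2 \<Rightarrow> ell2) \<Rightarrow> ell2 set \<Rightarrow> bool" where
  "is_global_attractor F A \<longleftrightarrow>
     compact A \<and>
     (\<forall>t\<ge>0. flow F t ` A = A) \<and>
     (\<forall>r>0. ((\<lambda>t. hausdorff_semidist (flow F t ` cball 0 r) A) \<longlongrightarrow> 0) at_top)"

text \<open>The solution operator of the implicit Euler scheme with step size \<open>\<epsilon>\<close>, the iterates being
  confined to the ball of radius \<open>r\<close>: outside that ball the implicit equation may have further
  solutions.\<close>

definition is_euler_solution ::
  "(ell2 \<Rightarrow> ell2) \<Rightarrow> real \<Rightarrow> real \<Rightarrow> ell2 \<Rightarrow> (nat \<Rightarrow> ell2) \<Rightarrow> bool" where
  "is_euler_solution F r \<epsilon> y u \<longleftrightarrow>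
     u 0 = y \<and> (\<forall>n. u n \<in> cball 0 r) \<and> (\<forall>n\<ge>1. u n = u (n - 1) + \<epsilon> *\<^sub>R F (u n))"

definition euler_flow ::
  "(ell2 \<Rightarrow> ell2) \<Rightarrow> real \<Rightarrow> real \<Rightarrow> nat \<Rightarrow> ell2 \<Rightarrow> ell2" where
  "euler_flow F r \<epsilon> n y = (THE u. is_euler_solution F r \<epsilon> y u) n"

definition is_numerical_attractor ::
  "(ell2 \<Rightarrow> ell2) \<Rightarrow> real \<Rightarrow> real \<Rightarrow> ell2 set \<Rightarrow> bool" where
  "is_numerical_attractor F r \<epsilon> A \<longleftrightarrow>
     compact A \<and> A \<subseteq> cball 0 r \<and>
     (\<forall>n. euler_flow F r \<epsilon> n ` A = A) \<and>
     (\<lambda>n. hausdorff_semidist (euler_flow F r \<epsilon> n ` cball 0 r) A) \<longlonglongrightarrow> 0"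

end

theory Submission
  imports Defs
begin

text \<open>The field \<open>F\<close> is bounded and Lipschitz on the ball of radius \<open>r\<^sup>* + 1\<close> and satisfies
  \<open>F u \<bullet> u \<le> 0\<close> whenever \<open>\<parallel>u\<parallel> \<ge> r\<^sup>*\<close>, because
  \<open>F u \<bullet> u \<le> \<parallel>f\<parallel> \<parallel>u\<parallel> - (\<lambda> - \<lambda>\<^sup>*) \<parallel>u\<parallel>\<^sup>2\<close>. Hence the flow and the Euler scheme both exist
  and leave the ball \<open>B\<close> of radius \<open>r\<^sup>*\<close> invariant. Every point of the numerical attractor is an
  Euler iterate, of any prescribed order \<open>n\<close>, of some \<open>y \<in> B\<close>. For \<open>\<epsilon> \<rightarrow> 0\<close> and \<open>n \<epsilon>\<close> close to
  a fixed large time it is within \<open>O(\<epsilon>)\<close> of a point of the flow image of \<open>B\<close>, which is near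
  the global attractor. For \<open>\<epsilon> \<rightarrow> \<epsilon>\<^sub>0\<close> and a fixed large \<open>n\<close> it is within
  \<open>O(\<bar>\<epsilon> - \<epsilon>\<^sub>0\<bar>)\<close> of the \<open>\<epsilon>\<^sub>0\<close>-iterate of \<open>y\<close>, which is near the numerical attractor
  for \<open>\<epsilon>\<^sub>0\<close>.\<close>

subsection \<open>Completeness of the sequence space\<close>

lemma norm_ell2_power2: "(norm u)\<^sup>2 = (\<Sum>\<^sub>\<infinity>i. (seq_of u i)\<^sup>2)"
  unfolding norm_ell2_def by (rule real_sqrt_pow2) (simp add: infsum_nonneg)

lemma summable_seq_of_power2: "(\<lambda>i. (seq_of u i)\<^sup>2) summable_on UNIV"
  using square_summable_seq_of[of u] by (simp add: square_summable_def)

lemma sum_seq_of_power2_le: "finite S \<Longrightarrow> (\<Sum>i\<in>S. (seq_of u i)\<^sup>2) \<le> (norm u)\<^sup>2"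
  unfolding norm_ell2_power2
  by (rule finite_sum_le_infsum) (auto intro: summable_seq_of_power2)

lemma abs_seq_of_le_norm: "\<bar>seq_of u i\<bar> \<le> norm u"
  using sum_seq_of_power2_le[of "{i}" u] abs_le_square_iff[of "seq_of u i" "norm u"] by simp

text \<open>Finite partial sums pass to coordinatewise limits, so this criterion yields membership
  in \<open>ell2\<close> and a norm bound for sequences known only as such limits.\<close>

lemma ell2_of_sum_bound:
  fixes x :: "int \<Rightarrow> real"
  assumes "0 \<le> c" and bound: "\<And>S. finite S \<Longrightarrow> (\<Sum>i\<in>S. (x i)\<^sup>2) \<le> c\<^sup>2"
  obtains u where "seq_of u = x" "norm u \<le> c"
proof
  have summable: "(\<lambda>i. (x i)\<^sup>2) summable_on UNIV"
    by (rule nonneg_bdd_above_summable_on) (auto intro!: bdd_aboveI2[where M = "c\<^sup>2"] bound)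
  then show eq: "seq_of (Abs_ell2 x) = x"
    by (simp add: Abs_ell2_inverse square_summable_def)
  have "(norm (Abs_ell2 x))\<^sup>2 \<le> c\<^sup>2"
    unfolding norm_ell2_power2 eq by (rule infsum_le_finite_sums[OF summable bound])
  then show "norm (Abs_ell2 x) \<le> c"
    using \<open>0 \<le> c\<close> by (rule power2_le_imp_le)
qed

instance ell2 :: banach
proof
  fix X :: "nat \<Rightarrow> ell2"
  assume "Cauchy X"
  have "Cauchy (\<lambda>n. seq_of (X n) i)" for i
  proof (rule metric_CauchyI)
    fix e :: real assume "0 < e"
    then obtain N where N: "\<And>m n. m \<ge> N \<Longrightarrow> n \<ge> N \<Longrightarrow> dist (X m) (X n) < e"
      using metric_CauchyD[OF \<open>Cauchy X\<close>] by blast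
    show "\<exists>N. \<forall>m\<ge>N. \<forall>n\<ge>N. dist (seq_of (X m) i) (seq_of (X n) i) < e"
    proof (intro exI allI impI)
      fix m n assume "m \<ge> N" "n \<ge> N"
      have "dist (seq_of (X m) i) (seq_of (X n) i) \<le> dist (X m) (X n)"
        using abs_seq_of_le_norm[of "X m - X n" i] by (simp add: dist_norm minus_ell2.rep_eq)
      then show "dist (seq_of (X m) i) (seq_of (X n) i) < e"
        using N[OF \<open>m \<ge> N\<close> \<open>n \<ge> N\<close>] by linarith
    qed
  qed
  then have x: "(\<lambda>n. seq_of (X n) i) \<longlonglongrightarrow> lim (\<lambda>n. seq_of (X n) i)" for i
    by (simp add: Cauchy_convergent_iff convergent_LIMSEQ_iff)
  define x where "x i = lim (\<lambda>n. seq_of (X n) i)" for i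
  note x = x[folded x_def]
  \<comment> \<open>The pointwise limit \<open>x\<close> is not yet known to lie in
    \<open>ell2\<close>. Its differences to \<open>X n\<close> do, by letting \<open>m\<close> tend
    to infinity in the Cauchy estimate over each finite index set.\<close>
  have limit: "\<exists>u. seq_of u = (\<lambda>i. x i - seq_of (X n) i) \<and> norm u \<le> e"
    if "0 < e" and N: "\<And>m n. m \<ge> N \<Longrightarrow> n \<ge> N \<Longrightarrow> dist (X m) (X n) < e" and "n \<ge> N" for e N n
  proof -
    have "(\<Sum>i\<in>S. (x i - seq_of (X n) i)\<^sup>2) \<le> e\<^sup>2" if "finite S" for S
    proof (rule LIMSEQ_le_const2)
      show "(\<lambda>m. \<Sum>i\<in>S. (seq_of (X m) i - seq_of (X n) i)\<^sup>2)
          \<longlonglongrightarrow> (\<Sum>i\<in>S. (x i - seq_of (X n) i)\<^sup>2)"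
        by (intro tendsto_intros x)
      have "(\<Sum>i\<in>S. (seq_of (X m) i - seq_of (X n) i)\<^sup>2) \<le> e\<^sup>2" if "m \<ge> N" for m
      proof -
        have "(\<Sum>i\<in>S. (seq_of (X m) i - seq_of (X n) i)\<^sup>2) \<le> (norm (X m - X n))\<^sup>2"
          using sum_seq_of_power2_le[OF \<open>finite S\<close>, of "X m - X n"]
          by (simp add: minus_ell2.rep_eq)
        also have "\<dots> \<le> e\<^sup>2"
          using N[OF that \<open>n \<ge> N\<close>] by (intro power_mono) (auto simp: dist_norm)
        finally show ?thesis .
      qed
      then show "\<exists>N. \<forall>m\<ge>N. (\<Sum>i\<in>S. (seq_of (X m) i - seq_of (X n) i)\<^sup>2) \<le> e\<^sup>2"
        by blast
    qed
    then show ?thesis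
      using ell2_of_sum_bound[of e "\<lambda>i. x i - seq_of (X n) i"] \<open>0 < e\<close> by auto
  qed
  obtain N where N: "\<And>m n. m \<ge> N \<Longrightarrow> n \<ge> N \<Longrightarrow> dist (X m) (X n) < 1"
    using metric_CauchyD[OF \<open>Cauchy X\<close> zero_less_one] by blast
  \<comment> \<open>Adding \<open>X N\<close> back to one such difference turns \<open>x\<close>
    itself into an element of \<open>ell2\<close>.\<close>
  then obtain v where "seq_of v = (\<lambda>i. x i - seq_of (X N) i)"
    using limit[OF zero_less_one N order_refl] by blast
  then have y: "seq_of (v + X N) i = x i" for i
    by (simp add: plus_ell2.rep_eq)
  have "X \<longlonglongrightarrow> v + X N"
  proof (rule metric_LIMSEQ_I)
    fix e :: real assume "0 < e"
    then obtain N' where N': "\<And>m n. m \<ge> N' \<Longrightarrow> n \<ge> N' \<Longrightarrow> dist (X m) (X n) < e / 2"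
      using metric_CauchyD[OF \<open>Cauchy X\<close> half_gt_zero] by blast
    have "dist (X n) (v + X N) < e" if n: "n \<ge> N'" for n
    proof -
      obtain u where u: "seq_of u = (\<lambda>i. x i - seq_of (X n) i)" "norm u \<le> e / 2"
        using limit[OF half_gt_zero[OF \<open>0 < e\<close>] N' n] by blast
      have "u = v + X N - X n"
        by (rule seq_of_inject[THEN iffD1]) (auto simp: fun_eq_iff minus_ell2.rep_eq u y)
      then show ?thesis
        using u \<open>0 < e\<close> by (simp add: dist_norm norm_minus_commute)
    qed
    then show "\<exists>N'. \<forall>n\<ge>N'. dist (X n) (v + X N) < e"
      by blast
  qed
  then show "convergent X"
    by (rule convergentI)
qed

subsection \<open>Estimates for the vector field\<close>

lift_definition ell2_shift :: "int \<Rightarrow> ell2 \<Rightarrow> ell2" is "\<lambda>k u i. u (i + k)"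
  by (rule square_summable_shift)

lift_definition ell2_mult :: "ell2 \<Rightarrow> ell2 \<Rightarrow> ell2" is "\<lambda>u v i. u i * v i"
  by (rule square_summable_mult)

lemma norm_ell2_shift: "norm (ell2_shift k u) = norm u"
  unfolding norm_ell2_def ell2_shift.rep_eq
  by (subst infsum_reindex_bij_betw[where g = "\<lambda>i. i + k" and A = UNIV and B = UNIV
        and f = "\<lambda>i. (seq_of u i)\<^sup>2"]) (auto simp: bij_plus_right)

lemma ell2_shift_diff: "ell2_shift k (u - v) = ell2_shift k u - ell2_shift k v"
  by transfer auto

text \<open>Each coordinate of \<open>u\<close> is at most \<open>norm u\<close> in absolute value,
  so multiplication by \<open>u\<close> scales every coordinate of \<open>v\<close> by at most that
  factor.\<close>

lemma norm_ell2_mult_le: "norm (ell2_mult u v) \<le> norm u * norm v"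
proof (rule power2_le_imp_le)
  have "(norm (ell2_mult u v))\<^sup>2 \<le> (\<Sum>\<^sub>\<infinity>i. (norm u)\<^sup>2 * (seq_of v i)\<^sup>2)"
    unfolding norm_ell2_power2[of "ell2_mult u v"]
  proof (rule infsum_mono)
    show "(seq_of (ell2_mult u v) i)\<^sup>2 \<le> (norm u)\<^sup>2 * (seq_of v i)\<^sup>2" for i
      using power_mono[OF abs_seq_of_le_norm[of u i], of 2]
      by (simp add: ell2_mult.rep_eq power_mult_distrib mult_right_mono)
  qed (intro summable_seq_of_power2 summable_on_cmult_right)+
  also have "\<dots> = (norm u * norm v)\<^sup>2"
    by (simp add: norm_ell2_power2[of v] power_mult_distrib infsum_cmult_right'
        summable_seq_of_power2)
  finally show "(norm (ell2_mult u v))\<^sup>2 \<le> (norm u * norm v)\<^sup>2" .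
qed simp

lemma ell2_mult_diff_left: "ell2_mult (u - v) w = ell2_mult u w - ell2_mult v w"
  and ell2_mult_diff_right: "ell2_mult u (v - w) = ell2_mult u v - ell2_mult u w"
  by (transfer; auto simp: algebra_simps)+

text \<open>Self-adjointness of multiplication by \<open>u\<close>: it moves a factor across the
  inner product, so that the nonlinear terms tested with \<open>u\<close> become inner products with
  the square of \<open>u\<close>.\<close>

lemma inner_ell2_mult: "ell2_mult u v \<bullet> w = v \<bullet> ell2_mult u w"
  unfolding inner_ell2_def ell2_mult.rep_eq by (simp add: mult_ac)

definition ell2_Lap :: "ell2 \<Rightarrow> ell2" where
  "ell2_Lap u = 2 *\<^sub>R u - ell2_shift (-1) u - ell2_shift 1 u"

definition ell2_Dminus :: "ell2 \<Rightarrow> ell2" where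
  "ell2_Dminus u = ell2_shift (-1) u - u"

lemma norm_ell2_Lap_le: "norm (ell2_Lap u) \<le> 4 * norm u"
proof -
  have "norm (ell2_Lap u) \<le> norm (2 *\<^sub>R u) + norm (ell2_shift (-1) u) + norm (ell2_shift 1 u)"
    unfolding ell2_Lap_def by (intro norm_triangle_le norm_triangle_le_diff add_mono order_refl)
  then show ?thesis
    by (simp add: norm_ell2_shift)
qed

lemma norm_ell2_Dminus_le: "norm (ell2_Dminus u) \<le> 2 * norm u"
  unfolding ell2_Dminus_def
  using norm_triangle_ineq4[of "ell2_shift (-1) u" u] by (simp add: norm_ell2_shift)

lemma ell2_Lap_diff: "ell2_Lap (u - v) = ell2_Lap u - ell2_Lap v"
  by (simp add: ell2_Lap_def ell2_shift_diff algebra_simps)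

lemma ell2_Dminus_diff: "ell2_Dminus (u - v) = ell2_Dminus u - ell2_Dminus v"
  by (simp add: ell2_Dminus_def ell2_shift_diff algebra_simps)

text \<open>The reaction term u(1-u)(u-\<gamma>) is multiplied out because nonzero constant
  sequences such as 1 do not belong to \<open>ell2\<close>.\<close>

definition ell2_cubic :: "real \<Rightarrow> ell2 \<Rightarrow> ell2" where
  "ell2_cubic \<gamma> u = (1 + \<gamma>) *\<^sub>R ell2_mult u u - ell2_mult u (ell2_mult u u) - \<gamma> *\<^sub>R u"

lemma vector_field_eq:
  "vector_field \<alpha> \<beta> \<nu> lam \<gamma> f u =
    \<nu> *\<^sub>R ell2_Lap u - \<alpha> *\<^sub>R ell2_mult u (ell2_Dminus u) + \<beta> *\<^sub>R ell2_cubic \<gamma> u - lam *\<^sub>R u + f"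
  unfolding ell2_Lap_def ell2_Dminus_def ell2_cubic_def
  by transfer (auto simp: Lap_def Dminus_def fun_eq_iff algebra_simps)

section \<open>Growth, Lipschitz and dissipativity estimates\<close>

lemma norm_vector_field_le:
  assumes "0 \<le> \<alpha>" "0 \<le> \<beta>" "0 \<le> \<nu>" "0 \<le> lam" "0 \<le> \<gamma>" and "norm u \<le> r"
  shows "norm (vector_field \<alpha> \<beta> \<nu> lam \<gamma> f u) \<le> M_const \<alpha> \<beta> \<nu> lam \<gamma> f r"
proof -
  have r: "0 \<le> r"
    using assms(6) norm_ge_zero[of u] by linarith
  have uu: "norm (ell2_mult u u) \<le> r * r"
    using norm_ell2_mult_le[of u u] mult_mono[OF assms(6) assms(6) r] by simp
  have uuu: "norm (ell2_mult u (ell2_mult u u)) \<le> r * (r * r)"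
    using norm_ell2_mult_le[of u "ell2_mult u u"] mult_mono[OF assms(6) uu r] by simp
  have 1: "norm (\<nu> *\<^sub>R ell2_Lap u) \<le> \<nu> * (4 * r)"
    using norm_ell2_Lap_le[of u] assms by (auto intro!: mult_left_mono)
  have D: "norm (ell2_Dminus u) \<le> 2 * r"
    using norm_ell2_Dminus_le[of u] assms(6) by linarith
  have "norm (ell2_mult u (ell2_Dminus u)) \<le> r * (2 * r)"
    using norm_ell2_mult_le[of u "ell2_Dminus u"] mult_mono[OF assms(6) D r] by simp
  then have 2: "norm (\<alpha> *\<^sub>R ell2_mult u (ell2_Dminus u)) \<le> \<alpha> * (r * (2 * r))"
    using assms(1) by (auto intro!: mult_left_mono)
  have "norm (ell2_cubic \<gamma> u) \<le> norm ((1 + \<gamma>) *\<^sub>R ell2_mult u u)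
      + norm (ell2_mult u (ell2_mult u u)) + norm (\<gamma> *\<^sub>R u)"
    unfolding ell2_cubic_def by (intro norm_triangle_le norm_triangle_le_diff add_mono order_refl)
  also have "\<dots> \<le> (1 + \<gamma>) * (r * r) + r * (r * r) + \<gamma> * r"
    using uu uuu assms by (auto intro!: add_mono mult_left_mono)
  finally have 3: "norm (\<beta> *\<^sub>R ell2_cubic \<gamma> u)
      \<le> \<beta> * ((1 + \<gamma>) * (r * r) + r * (r * r) + \<gamma> * r)"
    using assms(2) by (auto intro!: mult_left_mono)
  have 4: "norm (lam *\<^sub>R u) \<le> lam * r"
    using assms by (auto intro!: mult_left_mono)
  have "norm (vector_field \<alpha> \<beta> \<nu> lam \<gamma> f u) \<le> norm (\<nu> *\<^sub>R ell2_Lap u)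
      + norm (\<alpha> *\<^sub>R ell2_mult u (ell2_Dminus u)) + norm (\<beta> *\<^sub>R ell2_cubic \<gamma> u)
      + norm (lam *\<^sub>R u) + norm f"
    unfolding vector_field_eq by (intro norm_triangle_le norm_triangle_le_diff add_mono order_refl)
  also have "\<dots> \<le> M_const \<alpha> \<beta> \<nu> lam \<gamma> f r"
    using 1 2 3 4
    unfolding M_const_def by (simp add: algebra_simps power2_eq_square power3_eq_cube)
  finally show ?thesis .
qed

lemma norm_ell2_cubic_diff_le:
  assumes "0 \<le> \<gamma>" and u: "norm u \<le> r" and v: "norm v \<le> r"
  shows "norm (ell2_cubic \<gamma> u - ell2_cubic \<gamma> v)
    \<le> sqrt (12 * r\<^sup>2 * (1 + \<gamma>)\<^sup>2 + 27 * r^4 + 3 * \<gamma>\<^sup>2) * norm (u - v)"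
proof -
  define w where "w = u - v"
  have r: "0 \<le> r"
    using u norm_ge_zero[of u] by linarith
  have prod_le: "norm (ell2_mult x y) \<le> r * r" if "norm x \<le> r" "norm y \<le> r" for x y
    using norm_ell2_mult_le[of x y] mult_mono[OF that r] by simp
  \<comment> \<open>The factor \<open>w\<close> is split off from the differences of squares and of
    cubes.\<close>
  have "ell2_cubic \<gamma> u - ell2_cubic \<gamma> v = (1 + \<gamma>) *\<^sub>R ell2_mult (u + v) w
      - ell2_mult (ell2_mult u u + ell2_mult u v + ell2_mult v v) w - \<gamma> *\<^sub>R w"
    unfolding ell2_cubic_def w_def by transfer (auto simp: fun_eq_iff algebra_simps)
  then have "norm (ell2_cubic \<gamma> u - ell2_cubic \<gamma> v) \<le> norm ((1 + \<gamma>) *\<^sub>R ell2_mult (u + v) w)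
      + norm (ell2_mult (ell2_mult u u + ell2_mult u v + ell2_mult v v) w) + norm (\<gamma> *\<^sub>R w)"
    by (simp only:) (intro norm_triangle_le norm_triangle_le_diff add_mono order_refl)
  also have "\<dots> \<le> (1 + \<gamma>) * ((r + r) * norm w) + (r * r + r * r + r * r) * norm w + \<gamma> * norm w"
  proof (intro add_mono)
    have "norm (u + v) \<le> r + r"
      using u v norm_triangle_le add_mono by blast
    then have "norm (ell2_mult (u + v) w) \<le> (r + r) * norm w"
      by (meson norm_ell2_mult_le mult_right_mono norm_ge_zero order_trans)
    then show "norm ((1 + \<gamma>) *\<^sub>R ell2_mult (u + v) w) \<le> (1 + \<gamma>) * ((r + r) * norm w)"
      using assms(1) by (auto intro!: mult_left_mono)
    have "norm (ell2_mult u u + ell2_mult u v + ell2_mult v v) \<le> r * r + r * r + r * r"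
      by (intro norm_triangle_le add_mono prod_le u v)
    then show "norm (ell2_mult (ell2_mult u u + ell2_mult u v + ell2_mult v v) w)
        \<le> (r * r + r * r + r * r) * norm w"
      by (meson norm_ell2_mult_le mult_right_mono norm_ge_zero order_trans)
  qed (use assms(1) in auto)
  also have "\<dots> = (2 * r * (1 + \<gamma>) + 3 * r\<^sup>2 + \<gamma>) * norm w"
    by (simp add: algebra_simps power2_eq_square)
  also have "\<dots> \<le> sqrt (12 * r\<^sup>2 * (1 + \<gamma>)\<^sup>2 + 27 * r^4 + 3 * \<gamma>\<^sup>2) * norm w"
  proof (intro mult_right_mono real_le_rsqrt)
    \<comment> \<open>This inequality for three summands is the origin of the square root in
      \<open>L_const\<close>.\<close>
    have "(a + b + c)\<^sup>2 \<le> 3 * (a\<^sup>2 + b\<^sup>2 + c\<^sup>2)" for a b c :: real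
      using zero_le_power2[of "a - b"] zero_le_power2[of "a - c"] zero_le_power2[of "b - c"]
      by (simp add: power2_eq_square algebra_simps)
    moreover have "3 * ((2 * r * (1 + \<gamma>))\<^sup>2 + (3 * r\<^sup>2)\<^sup>2 + \<gamma>\<^sup>2)
        = 12 * r\<^sup>2 * (1 + \<gamma>)\<^sup>2 + 27 * r^4 + 3 * \<gamma>\<^sup>2"
      by algebra
    ultimately
    show "(2 * r * (1 + \<gamma>) + 3 * r\<^sup>2 + \<gamma>)\<^sup>2 \<le> 12 * r\<^sup>2 * (1 + \<gamma>)\<^sup>2 + 27 * r^4 + 3 * \<gamma>\<^sup>2"
      by metis
  qed simp
  finally show ?thesis
    by (simp add: w_def)
qed

lemma vector_field_lipschitz:
  assumes "0 \<le> \<alpha>" "0 \<le> \<beta>" "0 \<le> \<nu>" "0 \<le> lam" "0 \<le> \<gamma>" and u: "norm u \<le> r" and v: "norm v \<le> r"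
  shows "norm (vector_field \<alpha> \<beta> \<nu> lam \<gamma> f u - vector_field \<alpha> \<beta> \<nu> lam \<gamma> f v)
    \<le> L_const \<alpha> \<beta> \<nu> lam \<gamma> r * norm (u - v)"
proof -
  define w where "w = u - v"
  define c where "c = sqrt (12 * r\<^sup>2 * (1 + \<gamma>)\<^sup>2 + 27 * r^4 + 3 * \<gamma>\<^sup>2)"
  have r: "0 \<le> r"
    using u norm_ge_zero[of u] by linarith
  have Dv: "norm (ell2_Dminus v) \<le> 2 * r"
    using norm_ell2_Dminus_le[of v] v by linarith
  \<comment> \<open>The product rule for differences; its two terms together contribute the constant
    \<open>4 * r\<close>.\<close>
  have "ell2_mult u (ell2_Dminus u) - ell2_mult v (ell2_Dminus v)
      = ell2_mult u (ell2_Dminus w) + ell2_mult w (ell2_Dminus v)"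
    by (simp add: w_def ell2_Dminus_diff ell2_mult_diff_left ell2_mult_diff_right)
  also have "norm \<dots> \<le> r * (2 * norm w) + (2 * r) * norm w"
  proof (intro norm_triangle_le add_mono)
    show "norm (ell2_mult u (ell2_Dminus w)) \<le> r * (2 * norm w)"
      using norm_ell2_mult_le[of u "ell2_Dminus w"] mult_mono[OF u norm_ell2_Dminus_le[of w] r]
      by simp
    show "norm (ell2_mult w (ell2_Dminus v)) \<le> (2 * r) * norm w"
      using norm_ell2_mult_le[of w "ell2_Dminus v"] mult_right_mono[OF Dv norm_ge_zero[of w]]
      by (simp add: mult.commute)
  qed
  also have "\<dots> \<le> (2 * sqrt 5 * r) * norm w"
  proof -
    \<comment> \<open>The estimate obtained is sharper than \<open>L_const\<close> asks for, so
      \<open>4 * r\<close> is enlarged to \<open>2 * sqrt 5 * r\<close>.\<close>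
    have "2 \<le> sqrt 5"
      by (rule real_le_rsqrt) simp
    then have "(4 * r) * norm w \<le> (2 * sqrt 5 * r) * norm w"
      using r by (intro mult_right_mono) auto
    then show ?thesis
      by simp
  qed
  finally have D: "norm (ell2_mult u (ell2_Dminus u) - ell2_mult v (ell2_Dminus v))
      \<le> (2 * sqrt 5 * r) * norm w" .
  have "vector_field \<alpha> \<beta> \<nu> lam \<gamma> f u - vector_field \<alpha> \<beta> \<nu> lam \<gamma> f v
      = \<nu> *\<^sub>R ell2_Lap w - \<alpha> *\<^sub>R (ell2_mult u (ell2_Dminus u) - ell2_mult v (ell2_Dminus v))
        + \<beta> *\<^sub>R (ell2_cubic \<gamma> u - ell2_cubic \<gamma> v) - lam *\<^sub>R w"
    by (simp add: vector_field_eq w_def ell2_Lap_diff algebra_simps)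
  then have "norm (vector_field \<alpha> \<beta> \<nu> lam \<gamma> f u - vector_field \<alpha> \<beta> \<nu> lam \<gamma> f v)
      \<le> norm (\<nu> *\<^sub>R ell2_Lap w)
        + norm (\<alpha> *\<^sub>R (ell2_mult u (ell2_Dminus u) - ell2_mult v (ell2_Dminus v)))
        + norm (\<beta> *\<^sub>R (ell2_cubic \<gamma> u - ell2_cubic \<gamma> v)) + norm (lam *\<^sub>R w)"
    by (simp only:) (intro norm_triangle_le norm_triangle_le_diff add_mono order_refl)
  also have "\<dots> \<le> \<nu> * (4 * norm w) + \<alpha> * ((2 * sqrt 5 * r) * norm w) + \<beta> * (c * norm w)
      + lam * norm w"
    using assms D norm_ell2_Lap_le[of w] norm_ell2_cubic_diff_le[OF assms(5) u v]
    by (auto intro!: add_mono mult_left_mono simp: w_def c_def)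
  also have "\<dots> = L_const \<alpha> \<beta> \<nu> lam \<gamma> r * norm w"
    by (simp add: L_const_def c_def algebra_simps)
  finally show ?thesis
    by (simp add: w_def)
qed

text \<open>Pairing with \<open>u\<close> turns the cubic damping into a negative multiple of the
  squared norm of \<open>P\<close>, the square of \<open>u\<close>. This absorbs the advection term
  and the quadratic part of the reaction.\<close>

lemma inner_vector_field_le:
  assumes "0 < \<alpha>" "0 < \<beta>" "0 < \<nu>" "0 < \<gamma>"
  shows "vector_field \<alpha> \<beta> \<nu> lam \<gamma> f u \<bullet> u
    \<le> norm f * norm u - (lam - lambda_star \<alpha> \<beta> \<nu> \<gamma>) * (norm u)\<^sup>2"
proof -
  define P where "P = ell2_mult u u"
  define p x where "p = norm P" and "x = norm u"
  \<comment> \<open>The total coefficient of \<open>x * p\<close>: advection gives 2\<alpha>, the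
    quadratic part of the reaction gives \<beta>(1+\<gamma>).\<close>
  define k where "k = 2 * \<alpha> + \<beta> + \<beta> * \<gamma>"
  have "vector_field \<alpha> \<beta> \<nu> lam \<gamma> f u \<bullet> u = \<nu> * (ell2_Lap u \<bullet> u) - \<alpha> * (ell2_Dminus u \<bullet> P)
      + \<beta> * ((1 + \<gamma>) * (P \<bullet> u) - P \<bullet> P - \<gamma> * (u \<bullet> u)) - lam * (u \<bullet> u) + f \<bullet> u"
    unfolding vector_field_eq ell2_cubic_def inner_diff_left inner_add_left inner_scaleR_left
      inner_ell2_mult[of u "ell2_Dminus u" u] inner_ell2_mult[of u "ell2_mult u u" u] P_def ..
  also have "\<dots> \<le> \<nu> * (4 * x\<^sup>2) + \<alpha> * (2 * x * p) + \<beta> * ((1 + \<gamma>) * (p * x) - p\<^sup>2 - \<gamma> * x\<^sup>2)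
      - lam * x\<^sup>2 + norm f * x"
  proof -
    have "ell2_Lap u \<bullet> u \<le> 4 * x\<^sup>2"
      using norm_cauchy_schwarz[of "ell2_Lap u" u]
        mult_right_mono[OF norm_ell2_Lap_le[of u] norm_ge_zero[of u]]
      by (simp add: x_def power2_eq_square)
    then have 1: "\<nu> * (ell2_Lap u \<bullet> u) \<le> \<nu> * (4 * x\<^sup>2)"
      using assms by (intro mult_left_mono) auto
    have "- (ell2_Dminus u \<bullet> P) \<le> 2 * x * p"
      using Cauchy_Schwarz_ineq2[of "ell2_Dminus u" P]
        mult_right_mono[OF norm_ell2_Dminus_le[of u] norm_ge_zero[of P]]
      by (simp add: x_def p_def)
    then have 2: "\<alpha> * (- (ell2_Dminus u \<bullet> P)) \<le> \<alpha> * (2 * x * p)"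
      using assms by (intro mult_left_mono) auto
    have 3: "\<beta> * ((1 + \<gamma>) * (P \<bullet> u) - P \<bullet> P - \<gamma> * (u \<bullet> u))
        \<le> \<beta> * ((1 + \<gamma>) * (p * x) - p\<^sup>2 - \<gamma> * x\<^sup>2)"
      using assms norm_cauchy_schwarz[of P u]
      by (simp add: x_def p_def power2_norm_eq_inner)
    show ?thesis
      using 1 2 3 norm_cauchy_schwarz[of f u] by (simp add: x_def power2_norm_eq_inner)
  qed
  also have "\<dots> = 4 * \<nu> * x\<^sup>2 + (k * (x * p) - \<beta> * p\<^sup>2) - \<beta> * \<gamma> * x\<^sup>2 - lam * x\<^sup>2 + norm f * x"
    by (simp add: k_def algebra_simps)
  also have "\<dots> \<le> 4 * \<nu> * x\<^sup>2 + k\<^sup>2 / (4 * \<beta>) * x\<^sup>2 - \<beta> * \<gamma> * x\<^sup>2 - lam * x\<^sup>2 + norm f * x"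
  proof -
    \<comment> \<open>Completing the square in \<open>p\<close> removes \<open>p\<close> altogether
      and produces the fraction in \<open>lambda_star\<close>.\<close>
    have "0 \<le> (k * x - 2 * \<beta> * p)\<^sup>2 / (4 * \<beta>)"
      using assms by simp
    also have "\<dots> = k\<^sup>2 / (4 * \<beta>) * x\<^sup>2 - (k * (x * p) - \<beta> * p\<^sup>2)"
      using assms by (simp add: field_simps power2_eq_square)
    finally show ?thesis
      by simp
  qed
  also have "\<dots> = norm f * x - (lam - lambda_star \<alpha> \<beta> \<nu> \<gamma>) * x\<^sup>2"
    by (simp add: lambda_star_def k_def algebra_simps)
  finally show ?thesis
    by (simp add: x_def)
qed

subsection \<open>Differential equations with an inward field\<close>

lemma has_real_derivative_norm_power2:
  fixes u :: "real \<Rightarrow> 'a :: real_inner"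
  assumes "(u has_vector_derivative u') (at t within S)"
  shows "((\<lambda>t. (norm (u t))\<^sup>2) has_real_derivative 2 * (u' \<bullet> u t)) (at t within S)"
  using bounded_bilinear.has_vector_derivative[OF bounded_bilinear_inner assms assms]
  by (simp add: has_real_derivative_iff_has_vector_derivative power2_norm_eq_inner inner_commute)

text \<open>A barrier argument: if \<open>g\<close> were positive at \<open>t\<close>, then after
  the last earlier time \<open>s\<close> with \<open>g s \<le> 0\<close> it would stay positive,
  hence could not increase, and \<open>g t \<le> g s\<close> would follow.\<close>

lemma nonpos_preserved:
  fixes g g' :: "real \<Rightarrow> real"
  assumes deriv: "\<And>t. t \<ge> 0 \<Longrightarrow> (g has_real_derivative g' t) (at t within {0..})"
    and "g 0 \<le> 0" and decr: "\<And>t. t \<ge> 0 \<Longrightarrow> g t > 0 \<Longrightarrow> g' t \<le> 0" and "t \<ge> 0"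
  shows "g t \<le> 0"
proof (rule ccontr)
  assume "\<not> g t \<le> 0"
  have cont: "continuous_on {0..} g"
    using deriv by (auto simp: continuous_on_eq_continuous_within intro: DERIV_continuous)
  define S where "S = {s \<in> {0..t}. g s \<le> 0}"
  have "closed S"
    unfolding S_def
    by (intro continuous_on_closed_Collect_le continuous_on_const continuous_on_subset[OF cont]) auto
  moreover have "S \<noteq> {}" "bdd_above S"
    using assms by (auto simp: S_def intro!: bdd_aboveI[where M = t])
  ultimately have "Sup S \<in> S"
    by (intro closed_contains_Sup)
  define s where "s = Sup S"
  have s: "0 \<le> s" "s \<le> t" "g s \<le> 0"
    using \<open>Sup S \<in> S\<close> by (auto simp: S_def s_def)
  have pos: "g x > 0" if "s < x" "x \<le> t" for x
  proof (rule ccontr)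
    assume "\<not> g x > 0"
    then have "x \<in> S"
      using that s by (auto simp: S_def)
    then show False
      using cSup_upper[OF _ \<open>bdd_above S\<close>, of x] that by (simp add: s_def)
  qed
  have "g t \<le> g s"
  proof (rule DERIV_nonpos_imp_decreasing_open[of s t g])
    show "continuous_on {s..t} g"
      using s by (intro continuous_on_subset[OF cont]) auto
    fix x assume x: "s < x" "x < t"
    then have "at x within {0..} = at x"
      using s by (intro at_within_interior) simp
    then show "\<exists>y. (g has_real_derivative y) (at x) \<and> y \<le> 0"
      using deriv[of x] decr[of x] pos[of x] x s by auto
  qed (use s in simp)
  then show False
    using s \<open>\<not> g t \<le> 0\<close> by simp
qed

text \<open>The squared norm has derivative \<open>2 * (G u \<bullet> u)\<close> along a solution,
  so the barrier argument applies to its excess over the square of \<open>r\<close>.\<close>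

lemma norm_le_if_inward:
  fixes G :: "'a :: real_inner \<Rightarrow> 'a"
  assumes u: "\<And>t. t \<ge> 0 \<Longrightarrow> (u has_vector_derivative G (u t)) (at t within {0..})"
    and inward: "\<And>v. r \<le> norm v \<Longrightarrow> G v \<bullet> v \<le> 0" and "0 \<le> r" "norm (u 0) \<le> r" "0 \<le> t"
  shows "norm (u t) \<le> r"
proof -
  have "(norm (u t))\<^sup>2 - r\<^sup>2 \<le> 0"
  proof (rule nonpos_preserved[OF _ _ _ \<open>0 \<le> t\<close>])
    show "((\<lambda>t. (norm (u t))\<^sup>2 - r\<^sup>2) has_real_derivative 2 * (G (u s) \<bullet> u s)) (at s within {0..})"
      if "s \<ge> 0" for s
      using DERIV_diff[OF has_real_derivative_norm_power2[OF u[OF that]] DERIV_const] by simp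
    show "(norm (u 0))\<^sup>2 - r\<^sup>2 \<le> 0"
      using assms by (simp add: power_mono)
    show "2 * (G (u s) \<bullet> u s) \<le> 0" if "(norm (u s))\<^sup>2 - r\<^sup>2 > 0" for s
      using inward[of "u s"] that power2_less_imp_less[of r "norm (u s)"] by simp
  qed
  then show ?thesis
    using \<open>0 \<le> r\<close> power2_le_imp_le[of "norm (u t)" r] by simp
qed

lemma indefinite_integral_has_vector_derivative:
  fixes h :: "real \<Rightarrow> 'a :: banach"
  assumes "continuous_on {0..} h" "t \<ge> 0"
  shows "((\<lambda>t. integral {0..t} h) has_vector_derivative h t) (at t within {0..})"
proof -
  have "((\<lambda>t. integral {0..t} h) has_vector_derivative h t) (at t within {0..t+1})"
    using assms by (intro integral_has_vector_derivative continuous_on_subset[OF assms(1)]) auto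
  \<comment> \<open>Only a neighbourhood of \<open>t\<close> matters; the extra 1 keeps
    \<open>t\<close> away from the right endpoint.\<close>
  moreover have "at t within {0..t+1} = at t within {0..}"
    using assms by (intro at_within_nhd[where S = "{..<t+1}"]) auto
  ultimately show ?thesis
    by simp
qed

text \<open>Integrating an exponential gains the factor 1/k. This gain is what makes the Picard
  operator contract in the weighted norm.\<close>

lemma norm_integral_le_exp:
  fixes h :: "real \<Rightarrow> 'a :: banach"
  assumes "continuous_on {0..} h" "0 < k" "0 \<le> t"
    and bound: "\<And>s. s \<ge> 0 \<Longrightarrow> norm (h s) \<le> c * exp (k * s)"
  shows "norm (integral {0..t} h) \<le> c / k * (exp (k * t) - 1)"
proof -
  have *: "((\<lambda>s. c * exp (k * s)) has_integral (c / k * exp (k * t) - c / k * exp (k * 0))) {0..t}"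
    using assms
    by (intro fundamental_theorem_of_calculus)
      (auto intro!: derivative_eq_intros simp flip: has_real_derivative_iff_has_vector_derivative)
  have "norm (integral {0..t} h) \<le> integral {0..t} (\<lambda>s. c * exp (k * s))"
    using assms * by (intro integral_norm_bound_integral integrable_continuous_real
        continuous_on_subset[OF assms(1)] continuous_intros) auto
  also have "\<dots> = c / k * (exp (k * t) - 1)"
    unfolding integral_unique[OF *] by (simp add: algebra_simps)
  finally show ?thesis .
qed

text \<open>The Picard operator is a contraction for the weighted supremum norm
  \<open>sup\<^sub>t exp (- k t) \<parallel>u t\<parallel>\<close> with \<open>k > K\<close>. The fixed point argument is carried out for
  \<open>v t = exp (- k t) u t\<close> in the space of bounded continuous functions.\<close>

lemma lipschitz_global_solution:
  fixes G :: "'a :: banach \<Rightarrow> 'a"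
  assumes bound: "\<And>u. norm (G u) \<le> M" and lipschitz: "\<And>u v. norm (G u - G v) \<le> K * norm (u - v)"
  shows "\<exists>u. u 0 = u0 \<and> (\<forall>t\<ge>0. (u has_vector_derivative G (u t)) (at t within {0..}))"
proof -
  have "0 \<le> M"
    using order_trans[OF norm_ge_zero bound] .
  \<comment> \<open>The sign of \<open>K\<close> is not known, hence the absolute value; adding 1
    makes the contraction factor \<open>\<bar>K\<bar> / k\<close> less than 1.\<close>
  define k where "k = \<bar>K\<bar> + 1"
  have k: "0 < k" "K < k"
    by (auto simp: k_def)
  have "(\<bar>K\<bar>)-lipschitz_on UNIV G"
  proof (rule lipschitz_onI)
    show "dist (G u) (G v) \<le> \<bar>K\<bar> * dist u v" for u v
      using lipschitz[of u v] mult_right_mono[OF abs_ge_self[of K] norm_ge_zero[of "u - v"]]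
      by (simp add: dist_norm)
  qed simp
  then have cont_G: "continuous_on UNIV G"
    by (rule lipschitz_on_continuous_on)
  define h :: "(real \<Rightarrow>\<^sub>C 'a) \<Rightarrow> real \<Rightarrow> 'a" where "h v s = G (exp (k * s) *\<^sub>R v s)" for v s
  have cont_h: "continuous_on S (h v)" for v S
    unfolding h_def
    by (intro continuous_on_compose2[OF cont_G] continuous_intros) auto
  define J where "J v t = u0 + integral {0..t} (h v)" for v t
  have deriv_J: "(J v has_vector_derivative h v t) (at t within {0..})" if "t \<ge> 0" for v t
    unfolding J_def[abs_def]
    using indefinite_integral_has_vector_derivative[OF cont_h that, of v]
    by (auto intro!: derivative_eq_intros)
  have cont_J: "continuous_on {0..} (J v)" for v
    using deriv_J by (auto simp: continuous_on_eq_continuous_within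
        intro: has_vector_derivative_continuous)
  \<comment> \<open>Bounded continuous functions live on the whole real line, so the weighted Picard
    image is extended to negative times by its value at 0.\<close>
  define \<Phi> where "\<Phi> v t = exp (- k * max 0 t) *\<^sub>R J v (max 0 t)" for v t
  have bcont: "\<Phi> v \<in> bcontfun" for v
  proof (rule bcontfun_normI)
    show "continuous_on UNIV (\<Phi> v)"
      unfolding \<Phi>_def by (intro continuous_intros continuous_on_compose2[OF cont_J]) auto
    fix t :: real
    define s where "s = max 0 t"
    have s: "0 \<le> s"
      by (simp add: s_def)
    have "norm (integral {0..s} (h v)) \<le> M / k * (exp (k * s) - 1)"
    proof (rule norm_integral_le_exp[OF cont_h k(1) s])
      show "norm (h v \<tau>) \<le> M * exp (k * \<tau>)" if "\<tau> \<ge> 0" for \<tau>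
        using bound[of "exp (k * \<tau>) *\<^sub>R v \<tau>"] mult_left_mono[of 1 "exp (k * \<tau>)" M] \<open>0 \<le> M\<close> k that
        by (simp add: h_def)
    qed
    also have "\<dots> \<le> exp (k * s) * (M / k)"
      using \<open>0 \<le> M\<close> k by (simp add: field_simps)
    also have "norm u0 \<le> exp (k * s) * norm u0"
      using mult_right_mono[of 1 "exp (k * s)" "norm u0"] k s by simp
    ultimately have "norm (J v s) \<le> exp (k * s) * (norm u0 + M / k)"
      unfolding J_def by (intro norm_triangle_le) (simp add: algebra_simps)
    then show "norm (\<Phi> v t) \<le> norm u0 + M / k"
      by (simp add: \<Phi>_def s_def exp_minus field_simps)
  qed
  define \<Psi> where "\<Psi> v = Bcontfun (\<Phi> v)" for v
  have \<Psi>: "apply_bcontfun (\<Psi> v) = \<Phi> v" for v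
    using bcont by (simp add: \<Psi>_def Bcontfun_inverse)
  have "\<exists>!v. \<Psi> v = v"
  proof (rule banach_fix_type)
    show "0 \<le> \<bar>K\<bar> / k" "\<bar>K\<bar> / k < 1"
      by (auto simp: k_def)
    show "\<forall>v w. dist (\<Psi> v) (\<Psi> w) \<le> \<bar>K\<bar> / k * dist v w"
    proof (intro allI dist_bound)
      fix v w :: "real \<Rightarrow>\<^sub>C 'a" and t :: real
      define s where "s = max 0 t"
      have s: "0 \<le> s"
        by (simp add: s_def)
      have "J v s - J w s = integral {0..s} (\<lambda>\<tau>. h v \<tau> - h w \<tau>)"
        unfolding J_def
        by (simp add: Henstock_Kurzweil_Integration.integral_diff integrable_continuous_real cont_h)
      also have "norm \<dots> \<le> \<bar>K\<bar> * dist v w / k * (exp (k * s) - 1)"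
      proof (rule norm_integral_le_exp[OF continuous_on_diff[OF cont_h cont_h] k(1) s])
        fix \<tau> :: real
        have "norm (h v \<tau> - h w \<tau>) \<le> K * (exp (k * \<tau>) * dist (v \<tau>) (w \<tau>))"
          using lipschitz[of "exp (k * \<tau>) *\<^sub>R v \<tau>" "exp (k * \<tau>) *\<^sub>R w \<tau>"]
          by (simp add: h_def dist_norm flip: scaleR_diff_right)
        also have "\<dots> \<le> \<bar>K\<bar> * (exp (k * \<tau>) * dist v w)"
          by (intro mult_mono mult_left_mono dist_bounded) auto
        finally show "norm (h v \<tau> - h w \<tau>) \<le> \<bar>K\<bar> * dist v w * exp (k * \<tau>)"
          by (simp add: mult_ac)
      qed
      also have "\<dots> \<le> \<bar>K\<bar> * dist v w / k * exp (k * s)"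
        using k by (intro mult_left_mono) auto
      finally have "norm (J v s - J w s) \<le> \<bar>K\<bar> * dist v w / k * exp (k * s)" .
      then have "exp (- k * s) * norm (J v s - J w s)
          \<le> exp (- k * s) * (\<bar>K\<bar> * dist v w / k * exp (k * s))"
        by (intro mult_left_mono) auto
      also have "\<dots> = \<bar>K\<bar> / k * dist v w"
        by (simp add: exp_minus)
      finally show "dist (\<Psi> v t) (\<Psi> w t) \<le> \<bar>K\<bar> / k * dist v w"
        by (simp add: \<Psi> \<Phi>_def s_def dist_norm flip: scaleR_diff_right)
    qed
  qed
  then obtain v where "\<Psi> v = v"
    by blast
  then have v: "v t = exp (- k * t) *\<^sub>R J v t" if "t \<ge> 0" for t
    using \<Psi>[of v] that by (simp add: \<Phi>_def)
  show ?thesis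
  proof (intro exI conjI allI impI)
    \<comment> \<open>The solution is \<open>J v\<close>: at the fixed point, removing the weight
      from \<open>v\<close> gives \<open>J v\<close>, so the integrand \<open>h v\<close> is
      \<open>G\<close> evaluated along \<open>J v\<close>.\<close>
    show "J v 0 = u0"
      by (simp add: J_def)
    show "(J v has_vector_derivative G (J v t)) (at t within {0..})" if "t \<ge> 0" for t
      using deriv_J[OF that, of v] v[OF that] by (simp add: h_def flip: exp_add)
  qed
qed

text \<open>The abstract setting for the flow and for the scheme. The margin of 1 between the two
  radii accommodates the cut-off function and the fixed point argument for one Euler step.\<close>

locale inward_field =
  fixes F :: "ell2 \<Rightarrow> ell2" and r M L :: real
  assumes r_nonneg: "0 \<le> r" and M_pos: "0 < M" and L_nonneg: "0 \<le> L"
    and bound: "norm u \<le> r + 1 \<Longrightarrow> norm (F u) \<le> M"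
    and lipschitz: "norm u \<le> r + 1 \<Longrightarrow> norm v \<le> r + 1 \<Longrightarrow> norm (F u - F v) \<le> L * norm (u - v)"
    and inward: "r \<le> norm u \<Longrightarrow> F u \<bullet> u \<le> 0"
begin

section \<open>Well-posedness of the flow on the ball of radius \<open>r\<close>\<close>

lemma norm_solution_le:
  assumes "is_solution F u0 u" "norm u0 \<le> r" "0 \<le> t"
  shows "norm (u t) \<le> r"
proof (rule norm_le_if_inward[of u F r t])
  show "(u has_vector_derivative F (u s)) (at s within {0..})" if "s \<ge> 0" for s
    using assms(1) that by (simp add: is_solution_def)
  show "norm (u 0) \<le> r" "0 \<le> t"
    using assms by (simp_all add: is_solution_def)
qed (rule r_nonneg inward, assumption?)+

text \<open>Gronwall's argument: both solutions stay in the region of Lipschitz continuity, so the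
  weight exp(-2Lt) makes the squared distance nonincreasing, and it starts at 0.\<close>

lemma solution_unique:
  assumes u: "is_solution F u0 u" and v: "is_solution F u0 v" and "norm u0 \<le> r" "0 \<le> t"
  shows "u t = v t"
proof -
  define w where "w t = u t - v t" for t
  have "exp (- 2 * L * t) * (norm (w t))\<^sup>2 \<le> 0"
  proof (rule nonpos_preserved[OF _ _ _ \<open>0 \<le> t\<close>])
    fix s :: real assume s: "s \<ge> 0"
    have "(w has_vector_derivative (F (u s) - F (v s))) (at s within {0..})"
      unfolding w_def[abs_def] using u v s unfolding is_solution_def
      by (intro has_vector_derivative_diff) auto
    note w' = has_real_derivative_norm_power2[OF this]
    have "((\<lambda>t. exp (- 2 * L * t)) has_real_derivative - 2 * L * exp (- 2 * L * s))
        (at s within {0..})"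
      by (auto intro!: derivative_eq_intros)
    from DERIV_mult[OF this w'] show "((\<lambda>t. exp (- 2 * L * t) * (norm (w t))\<^sup>2) has_real_derivative
        exp (- 2 * L * s) * (2 * ((F (u s) - F (v s)) \<bullet> w s) - 2 * L * (norm (w s))\<^sup>2))
        (at s within {0..})"
      by (rule DERIV_cong) (simp add: algebra_simps)
    have "norm (u s) \<le> r + 1" "norm (v s) \<le> r + 1"
      using norm_solution_le[OF u _ s] norm_solution_le[OF v _ s] assms by auto
    then have "norm (F (u s) - F (v s)) * norm (w s) \<le> L * norm (w s) * norm (w s)"
      unfolding w_def by (intro mult_right_mono lipschitz) auto
    then have "(F (u s) - F (v s)) \<bullet> w s \<le> L * (norm (w s))\<^sup>2"
      using norm_cauchy_schwarz[of "F (u s) - F (v s)" "w s"] by (simp add: power2_eq_square)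
    then show "exp (- 2 * L * s) * (2 * ((F (u s) - F (v s)) \<bullet> w s) - 2 * L * (norm (w s))\<^sup>2) \<le> 0"
      by (simp add: mult_nonneg_nonpos)
  qed (use u v in \<open>auto simp: is_solution_def w_def\<close>)
  then have "(norm (w t))\<^sup>2 \<le> 0"
    by (simp add: mult_le_0_iff)
  then show ?thesis
    by (simp add: w_def)
qed

text \<open>Multiplying \<open>F\<close> by a cut-off function that is 1 on the ball of radius \<open>r\<close> and vanishes
  outside the ball of radius \<open>r + 1\<close> gives a globally Lipschitz field which is still inward.\<close>

lemma solution_exists:
  assumes "norm u0 \<le> r"
  shows "\<exists>u. is_solution F u0 u"
proof -
  define cut where "cut u = max 0 (min 1 (r + 1 - norm u))" for u :: ell2
  define G where "G u = cut u *\<^sub>R F u" for u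
  have cut: "0 \<le> cut u" "cut u \<le> 1" "norm u > r + 1 \<Longrightarrow> cut u = 0" "norm u \<le> r \<Longrightarrow> cut u = 1" for u
    by (auto simp: cut_def)
  have cut_diff: "\<bar>cut u - cut v\<bar> \<le> norm (u - v)" for u v
    using norm_triangle_ineq3[of u v] unfolding cut_def by linarith
  have G_bound: "norm (G u) \<le> M" for u
  proof (cases "norm u \<le> r + 1")
    case True
    then show ?thesis
      using mult_mono[OF cut(2) bound[OF True]] cut(1)[of u] by (simp add: G_def)
  qed (use cut(3)[of u] M_pos in \<open>auto simp: G_def\<close>)
  \<comment> \<open>One point inside the larger ball suffices: \<open>F\<close> is then bounded
    there, and the variation of \<open>cut\<close> is controlled even if the other point lies
    outside.\<close>
  have G_inside: "norm (G u - G v) \<le> (M + L) * norm (u - v)" if u: "norm u \<le> r + 1" for u v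
  proof (cases "norm v \<le> r + 1")
    case True
    have "G u - G v = (cut u - cut v) *\<^sub>R F u + cut v *\<^sub>R (F u - F v)"
      by (simp add: G_def algebra_simps)
    also have "norm \<dots> \<le> norm (u - v) * M + 1 * (L * norm (u - v))"
      using mult_mono[OF cut_diff[of u v] bound[OF u]] mult_mono[OF cut(2) lipschitz[OF u True]] cut(1)[of v]
      by (intro norm_triangle_le add_mono) auto
    finally show ?thesis
      by (simp add: algebra_simps)
  next
    case False
    then have "norm (G u - G v) = \<bar>cut u - cut v\<bar> * norm (F u)"
      using cut(3)[of v] by (simp add: G_def)
    also have "\<dots> \<le> norm (u - v) * M"
      by (rule mult_mono[OF cut_diff bound[OF u]]) auto
    also have "\<dots> \<le> (M + L) * norm (u - v)"
      using L_nonneg by (simp add: algebra_simps)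
    finally show ?thesis .
  qed
  have G_lipschitz: "norm (G u - G v) \<le> (M + L) * norm (u - v)" for u v
  proof -
    consider "norm u \<le> r + 1" | "norm v \<le> r + 1" | "norm u > r + 1" "norm v > r + 1"
      by linarith
    then show ?thesis
    proof cases
      case 3
      then show ?thesis
        using cut(3) M_pos L_nonneg by (simp add: G_def)
    qed (use G_inside[of u v] G_inside[of v u] in \<open>auto simp: norm_minus_commute\<close>)
  qed
  obtain u where u0: "u 0 = u0"
    and u: "\<And>t. t \<ge> 0 \<Longrightarrow> (u has_vector_derivative G (u t)) (at t within {0..})"
    using lipschitz_global_solution[OF G_bound G_lipschitz, of u0] by auto
  \<comment> \<open>The factor \<open>cut\<close> is nonnegative, so \<open>G\<close> is still
    inward. The solution stays where \<open>cut\<close> is 1 and therefore solves the original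
    equation.\<close>
  have ball: "norm (u t) \<le> r" if "t \<ge> 0" for t
  proof (rule norm_le_if_inward[of u G r t])
    show "G v \<bullet> v \<le> 0" if "r \<le> norm v" for v
      using inward[OF that] cut(1)[of v] by (simp add: G_def mult_nonneg_nonpos)
  qed (use u0 assms that in \<open>simp_all add: u r_nonneg\<close>)
  have "is_solution F u0 u"
    unfolding is_solution_def
  proof (intro conjI allI impI)
    show "u 0 = u0"
      by (rule u0)
    show "continuous_on {0..} u"
      using u by (auto simp: continuous_on_eq_continuous_within
          intro: has_vector_derivative_continuous)
    show "(u has_vector_derivative F (u t)) (at t within {0..})" if "0 \<le> t" for t
      using u[OF that] cut(4)[OF ball[OF that]] by (simp add: G_def)
  qed
  then show ?thesis
    by blast
qed

lemma is_solution_cong: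
  assumes "is_solution F u0 u" "\<And>t. t \<ge> 0 \<Longrightarrow> v t = u t"
  shows "is_solution F u0 v"
  unfolding is_solution_def
proof (intro conjI allI impI)
  show "continuous_on {0..} v"
    using assms continuous_on_cong[OF refl, of "{0..}" v u] by (auto simp: is_solution_def)
  show "(v has_vector_derivative F (v t)) (at t within {0..})" if "0 \<le> t" for t
    by (rule has_vector_derivative_transform[of t "{0..}" v u])
      (use assms that in \<open>simp_all add: is_solution_def\<close>)
  show "v 0 = u0"
    using assms by (auto simp: is_solution_def)
qed

lemma is_solution_flow:
  assumes "norm u0 \<le> r"
  shows "is_solution F u0 (\<lambda>t. flow F t u0)"
proof -
  obtain u where u: "is_solution F u0 u"
    using solution_exists[OF assms] by blast
  \<comment> \<open>Solutions are determined only at nonnegative times; the restriction fixes the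
    remaining values, so the definite description in \<open>flow\<close> is meaningful.\<close>
  have "\<exists>!v. v \<in> extensional {0..} \<and> is_solution F u0 v"
  proof (rule ex1I)
    show "restrict u {0..} \<in> extensional {0..} \<and> is_solution F u0 (restrict u {0..})"
      using is_solution_cong[OF u] by auto
    show "v = restrict u {0..}" if "v \<in> extensional {0..} \<and> is_solution F u0 v" for v
      using that solution_unique[OF _ u assms] by (intro extensionalityI[of _ "{0..}"]) auto
  qed
  from theI'[OF this] show ?thesis
    unfolding flow_def by blast
qed

subsection \<open>The implicit Euler scheme\<close>

lemma solution_lipschitz:
  assumes u: "is_solution F u0 u" and "norm u0 \<le> r" "0 \<le> s" "0 \<le> t"
  shows "norm (u t - u s) \<le> M * \<bar>t - s\<bar>"
proof -
  have "norm (u t - u s) \<le> M * norm (t - s)"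
  proof (rule differentiable_bound[of "{0..}" u "\<lambda>t h. h *\<^sub>R F (u t)"])
    show "(u has_derivative (\<lambda>h. h *\<^sub>R F (u x))) (at x within {0..})" if "x \<in> {0..}" for x
      using u that by (simp add: is_solution_def has_vector_derivative_def)
    show "onorm (\<lambda>h. h *\<^sub>R F (u x)) \<le> M" if "x \<in> {0..}" for x
      using bound[of "u x"] norm_solution_le[OF u \<open>norm u0 \<le> r\<close>, of x] that
      by (intro onorm_le) (auto simp: mult.commute[of M] intro!: mult_left_mono)
  qed (use assms in auto)
  then show ?thesis
    by simp
qed

text \<open>Consistency of the implicit step: over a step of length \<epsilon> the velocity differs
  from its value at the right endpoint by at most \<open>L * M * \<epsilon>\<close>.\<close>

lemma local_error:
  assumes u: "is_solution F u0 u" and "norm u0 \<le> r" "0 \<le> t" "0 \<le> \<epsilon>"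
  shows "norm (u (t + \<epsilon>) - u t - \<epsilon> *\<^sub>R F (u (t + \<epsilon>))) \<le> L * M * \<epsilon>\<^sup>2"
proof -
  have "norm (u (t + \<epsilon>) - u t - (t + \<epsilon> - t) *\<^sub>R F (u (t + \<epsilon>))) \<le> norm (t + \<epsilon> - t) * (L * (M * \<epsilon>))"
  proof (rule vector_differentiable_bound_linearization[where S = "{t..t + \<epsilon>}"])
    show "(u has_vector_derivative F (u x)) (at x within {t..t + \<epsilon>})" if "x \<in> {t..t + \<epsilon>}" for x
      by (rule has_vector_derivative_within_subset[of u "F (u x)" x "{0..}" "{t..t + \<epsilon>}"])
        (use u that \<open>0 \<le> t\<close> in \<open>auto simp: is_solution_def\<close>)
    show "norm (F (u x) - F (u (t + \<epsilon>))) \<le> L * (M * \<epsilon>)" if "x \<in> {t..t + \<epsilon>}" for x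
    proof -
      have "norm (u y) \<le> r + 1" if "y \<ge> 0" for y
        using norm_solution_le[OF u \<open>norm u0 \<le> r\<close> that] by simp
      then have "norm (F (u x) - F (u (t + \<epsilon>))) \<le> L * norm (u x - u (t + \<epsilon>))"
        using that \<open>0 \<le> t\<close> by (intro lipschitz) auto
      also have "norm (u x - u (t + \<epsilon>)) \<le> M * \<bar>x - (t + \<epsilon>)\<bar>"
        using that \<open>0 \<le> t\<close> by (intro solution_lipschitz[OF u \<open>norm u0 \<le> r\<close>]) auto
      also have "\<dots> \<le> M * \<epsilon>"
        using that M_pos by (intro mult_left_mono) auto
      finally show ?thesis
        using L_nonneg by (simp add: mult_left_mono)
    qed
  qed (use assms in \<open>auto simp: closed_segment_eq_real_ivl\<close>)
  then show ?thesis
    using \<open>0 \<le> \<epsilon>\<close> by (simp add: power2_eq_square mult_ac)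
qed

text \<open>Banach's fixed point theorem applies in the ball of radius \<open>r + 1\<close>, which
  the step map preserves since \<open>\<epsilon> * M \<le> 1\<close>. Inwardness then returns the
  fixed point to radius \<open>r\<close>.\<close>

lemma euler_step_unique:
  assumes "0 \<le> \<epsilon>" "\<epsilon> * M \<le> 1" "\<epsilon> * L < 1" "norm y \<le> r"
  shows "\<exists>!u. u \<in> cball 0 r \<and> u = y + \<epsilon> *\<^sub>R F u"
proof -
  have fix_ex1: "\<exists>!u\<in>cball 0 (r + 1). y + \<epsilon> *\<^sub>R F u = u"
  proof (rule Banach_fix)
    show "(\<lambda>u. y + \<epsilon> *\<^sub>R F u) ` cball 0 (r + 1) \<subseteq> cball 0 (r + 1)"
    proof safe
      fix u :: ell2 assume "u \<in> cball 0 (r + 1)"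
      then have "norm (\<epsilon> *\<^sub>R F u) \<le> \<epsilon> * M"
        using assms(1) bound[of u] by (auto intro: mult_left_mono)
      then show "y + \<epsilon> *\<^sub>R F u \<in> cball 0 (r + 1)"
        using assms norm_triangle_ineq[of y "\<epsilon> *\<^sub>R F u"] by simp
    qed
    show "dist (y + \<epsilon> *\<^sub>R F u) (y + \<epsilon> *\<^sub>R F v) \<le> \<epsilon> * L * dist u v"
      if "u \<in> cball 0 (r + 1)" "v \<in> cball 0 (r + 1)" for u v
      using that lipschitz[of u v] assms(1)
      by (auto simp: dist_norm mult.assoc simp flip: scaleR_diff_right intro!: mult_left_mono)
  qed (use assms r_nonneg L_nonneg in \<open>auto simp: complete_eq_closed\<close>)
  \<comment> \<open>Pairing the step equation with \<open>u\<close> leaves at most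
    \<open>y \<bullet> u\<close> when the norm of \<open>u\<close> exceeds \<open>r\<close>, which
    forces that norm back to at most \<open>r\<close>.\<close>
  have inner: "norm u \<le> r" if "u = y + \<epsilon> *\<^sub>R F u" for u
  proof (rule ccontr)
    assume "\<not> norm u \<le> r"
    then have "F u \<bullet> u \<le> 0" "0 < norm u"
      using inward[of u] r_nonneg by auto
    have "norm u * norm u = y \<bullet> u + \<epsilon> * (F u \<bullet> u)"
      using arg_cong[OF that, of "\<lambda>v. v \<bullet> u"]
      by (simp add: inner_add_left power2_norm_eq_inner flip: power2_eq_square)
    also have "\<dots> \<le> r * norm u"
      using norm_cauchy_schwarz[of y u] mult_right_mono[OF assms(4), of "norm u"]
        mult_nonneg_nonpos[OF assms(1) \<open>F u \<bullet> u \<le> 0\<close>] by simp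
    finally show False
      using \<open>0 < norm u\<close> \<open>\<not> norm u \<le> r\<close> by simp
  qed
  obtain u where u: "y + \<epsilon> *\<^sub>R F u = u"
    and unique: "\<And>v. v \<in> cball 0 (r + 1) \<Longrightarrow> y + \<epsilon> *\<^sub>R F v = v \<Longrightarrow> v = u"
    using fix_ex1 by blast
  show ?thesis
  proof (rule ex1I)
    show "u \<in> cball 0 r \<and> u = y + \<epsilon> *\<^sub>R F u"
      using inner[of u] u by simp
    show "v = u" if "v \<in> cball 0 r \<and> v = y + \<epsilon> *\<^sub>R F v" for v
      using that by (intro unique) auto
  qed
qed

lemma is_euler_solutionD:
  assumes "is_euler_solution F r \<epsilon> y u"
  shows "u 0 = y" "norm (u n) \<le> r" "u (Suc n) = u n + \<epsilon> *\<^sub>R F (u (Suc n))"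
  using assms by (auto simp: is_euler_solution_def dest: spec[of _ "Suc n"])

text \<open>Iterating the unique one-step solution \<open>E\<close> gives a trajectory, and
  induction shows it is the only one, so the description in \<open>euler_flow\<close> denotes
  it.\<close>

lemma is_euler_solution_euler_flow:
  assumes "0 \<le> \<epsilon>" "\<epsilon> * M \<le> 1" "\<epsilon> * L < 1" "norm y \<le> r"
  shows "is_euler_solution F r \<epsilon> y (\<lambda>n. euler_flow F r \<epsilon> n y)"
proof -
  note step = euler_step_unique[OF assms(1-3)]
  define E where "E y = (THE u. u \<in> cball 0 r \<and> u = y + \<epsilon> *\<^sub>R F u)" for y
  have E: "E y \<in> cball 0 r \<and> E y = y + \<epsilon> *\<^sub>R F (E y)" if "norm y \<le> r" for y
    unfolding E_def by (rule theI'[OF step[OF that]])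
  have step_eq: "a = b" if "norm y \<le> r" "a \<in> cball 0 r \<and> a = y + \<epsilon> *\<^sub>R F a"
    "b \<in> cball 0 r \<and> b = y + \<epsilon> *\<^sub>R F b" for y a b
    by (rule trans[OF the1_equality[OF step[OF that(1)] that(2), symmetric]
          the1_equality[OF step[OF that(1)] that(3)]])
  define u where "u n = (E ^^ n) y" for n
  have u: "norm (u n) \<le> r" for n
    by (induction n) (use assms(4) E in \<open>auto simp: u_def\<close>)
  have "\<exists>!u. is_euler_solution F r \<epsilon> y u"
  proof (rule ex1I)
    show u_sol: "is_euler_solution F r \<epsilon> y u"
      unfolding is_euler_solution_def
    proof (intro conjI allI impI)
      show "u n = u (n - 1) + \<epsilon> *\<^sub>R F (u n)" if "n \<ge> 1" for n
        using that E[OF u[of "n - 1"]] by (cases n) (auto simp: u_def)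
    qed (use u in \<open>auto simp: u_def\<close>)
    show "v = u" if v: "is_euler_solution F r \<epsilon> y v" for v
    proof
      show "v n = u n" for n
      proof (induction n)
        case 0
        show ?case
          using v u_sol by (simp add: is_euler_solution_def)
      next
        case (Suc n)
        have "w (Suc n) \<in> cball 0 r \<and> w (Suc n) = w n + \<epsilon> *\<^sub>R F (w (Suc n))"
          if "is_euler_solution F r \<epsilon> y w" for w
          using is_euler_solutionD(2,3)[OF that] by simp
        from this[OF v] this[OF u_sol] show ?case
          using Suc step_eq[OF u[of n]] by simp
      qed
    qed
  qed
  from theI'[OF this] show ?thesis
    unfolding euler_flow_def .
qed

text \<open>The inverse of u - \<epsilon>Fu on the ball has Lipschitz constant at most
  1/(1-\<epsilon>L). An error committed before an implicit step is amplified by no more than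
  this.\<close>

lemma implicit_step_stable:
  assumes "norm u \<le> r" "norm v \<le> r" "0 \<le> \<epsilon>" "\<epsilon> * L < 1"
  shows "norm (u - v) \<le> norm ((u - \<epsilon> *\<^sub>R F u) - (v - \<epsilon> *\<^sub>R F v)) / (1 - \<epsilon> * L)"
proof -
  have "norm (\<epsilon> *\<^sub>R (F u - F v)) \<le> \<epsilon> * (L * norm (u - v))"
    using assms lipschitz[of u v] by (auto intro!: mult_left_mono)
  moreover have "norm (u - v) \<le> norm ((u - \<epsilon> *\<^sub>R F u) - (v - \<epsilon> *\<^sub>R F v)) + norm (\<epsilon> *\<^sub>R (F u - F v))"
    using norm_triangle_ineq[of "(u - \<epsilon> *\<^sub>R F u) - (v - \<epsilon> *\<^sub>R F v)" "\<epsilon> *\<^sub>R (F u - F v)"]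
    by (simp add: algebra_simps)
  ultimately show ?thesis
    using assms by (simp add: pos_le_divide_eq algebra_simps)
qed

text \<open>Stability and the local error give e(n+1) \<le> (e(n) +
  LM\<epsilon>\<epsilon>)/(1-\<epsilon>L) with e(0) = 0. The bound solves this recursion with
  equality.\<close>

lemma euler_global_error:
  assumes u: "is_solution F y u" and v: "is_euler_solution F r \<epsilon> y v"
    and "norm y \<le> r" "0 \<le> \<epsilon>" "\<epsilon> * L < 1"
  shows "norm (v n - u (real n * \<epsilon>)) \<le> \<epsilon> * M * ((1 / (1 - \<epsilon> * L)) ^ n - 1)"
proof (induction n)
  case 0
  then show ?case
    using u is_euler_solutionD(1)[OF v] by (simp add: is_solution_def)
next
  case (Suc n)
  define q where "q = 1 - \<epsilon> * L"
  have q: "q > 0"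
    using assms by (simp add: q_def)
  let ?t = "real n * \<epsilon>"
  have t: "0 \<le> ?t" "real (Suc n) * \<epsilon> = ?t + \<epsilon>"
    using assms by (auto simp: algebra_simps)
  have "norm (v (Suc n) - u (?t + \<epsilon>)) \<le> norm ((v (Suc n) - \<epsilon> *\<^sub>R F (v (Suc n)))
      - (u (?t + \<epsilon>) - \<epsilon> *\<^sub>R F (u (?t + \<epsilon>)))) / q"
    unfolding q_def using assms t is_euler_solutionD(2)[OF v]
    by (intro implicit_step_stable norm_solution_le[OF u]) auto
  also have "v (Suc n) - \<epsilon> *\<^sub>R F (v (Suc n)) = v n"
    using is_euler_solutionD(3)[OF v, of n] by (metis add_diff_cancel_right')
  also have "norm (v n - (u (?t + \<epsilon>) - \<epsilon> *\<^sub>R F (u (?t + \<epsilon>)))) / q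
      \<le> (\<epsilon> * M * ((1 / q) ^ n - 1) + L * M * \<epsilon>\<^sup>2) / q"
  proof (intro divide_right_mono)
    have "v n - (u (?t + \<epsilon>) - \<epsilon> *\<^sub>R F (u (?t + \<epsilon>)))
        = (v n - u ?t) - (u (?t + \<epsilon>) - u ?t - \<epsilon> *\<^sub>R F (u (?t + \<epsilon>)))"
      by simp
    also have "norm \<dots> \<le> \<epsilon> * M * ((1 / q) ^ n - 1) + L * M * \<epsilon>\<^sup>2"
      using assms t Suc.IH
      by (intro norm_triangle_le_diff[OF add_mono[OF _ local_error[OF u]]]) (auto simp: q_def)
    finally show "norm (v n - (u (?t + \<epsilon>) - \<epsilon> *\<^sub>R F (u (?t + \<epsilon>)))) \<le> \<dots>" .
  qed (use q in simp)
  also have "\<dots> = \<epsilon> * M * ((1 / q) ^ Suc n - 1)"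
  proof -
    have "L * M * \<epsilon>\<^sup>2 = \<epsilon> * M * (1 - q)"
      by (simp add: q_def power2_eq_square)
    then have "\<epsilon> * M * ((1 / q) ^ n - 1) + L * M * \<epsilon>\<^sup>2 = \<epsilon> * M * ((1 / q) ^ n - q)"
      by (simp add: algebra_simps)
    then show ?thesis
      using q by (simp only: times_divide_eq_right[symmetric]) (simp add: diff_divide_distrib)
  qed
  finally show ?case
    unfolding t(2) q_def .
qed

text \<open>The constant may depend on \<open>n\<close> and \<open>\<epsilon>\<^sub>0\<close> but is
  uniform in the initial point and in \<epsilon>. It grows with \<open>n\<close> through the
  stability factor of each step.\<close>

lemma euler_step_size_continuity:
  assumes "0 \<le> \<epsilon>\<^sub>0" "\<epsilon>\<^sub>0 * L < 1"
  obtains c where "\<And>\<epsilon> y u v. is_euler_solution F r \<epsilon> y u \<Longrightarrow> is_euler_solution F r \<epsilon>\<^sub>0 y v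
    \<Longrightarrow> norm (u n - v n) \<le> c * \<bar>\<epsilon> - \<epsilon>\<^sub>0\<bar>"
proof (induction n arbitrary: thesis)
  case 0
  show ?case
    by (rule 0[of 0]) (simp add: is_euler_solutionD(1))
next
  case (Suc n)
  obtain c where c: "\<And>\<epsilon> y u v. is_euler_solution F r \<epsilon> y u \<Longrightarrow> is_euler_solution F r \<epsilon>\<^sub>0 y v
    \<Longrightarrow> norm (u n - v n) \<le> c * \<bar>\<epsilon> - \<epsilon>\<^sub>0\<bar>"
    using Suc.IH by blast
  show ?case
  proof (rule Suc.prems)
    fix \<epsilon> y u v
    assume u: "is_euler_solution F r \<epsilon> y u" and v: "is_euler_solution F r \<epsilon>\<^sub>0 y v"
    \<comment> \<open>A step of size \<epsilon> is read as a step of size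
      \<open>\<epsilon>\<^sub>0\<close> whose starting point is perturbed, so stability is needed
      for \<open>\<epsilon>\<^sub>0\<close> only.\<close>
    have u_step: "u (Suc n) - \<epsilon>\<^sub>0 *\<^sub>R F (u (Suc n)) = u n + (\<epsilon> - \<epsilon>\<^sub>0) *\<^sub>R F (u (Suc n))"
      using is_euler_solutionD(3)[OF u, of n] by (simp add: algebra_simps)
    have v_step: "v (Suc n) - \<epsilon>\<^sub>0 *\<^sub>R F (v (Suc n)) = v n"
      using is_euler_solutionD(3)[OF v, of n] by (simp add: algebra_simps)
    have "norm (u (Suc n) - v (Suc n))
        \<le> norm ((u n + (\<epsilon> - \<epsilon>\<^sub>0) *\<^sub>R F (u (Suc n))) - v n) / (1 - \<epsilon>\<^sub>0 * L)"
      using implicit_step_stable[OF is_euler_solutionD(2)[OF u] is_euler_solutionD(2)[OF v] assms]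
      unfolding u_step[symmetric] v_step[symmetric] .
    also have "\<dots> \<le> (c * \<bar>\<epsilon> - \<epsilon>\<^sub>0\<bar> + \<bar>\<epsilon> - \<epsilon>\<^sub>0\<bar> * M) / (1 - \<epsilon>\<^sub>0 * L)"
    proof (intro divide_right_mono)
      have "(u n + (\<epsilon> - \<epsilon>\<^sub>0) *\<^sub>R F (u (Suc n))) - v n = (u n - v n) + (\<epsilon> - \<epsilon>\<^sub>0) *\<^sub>R F (u (Suc n))"
        by simp
      also have "norm \<dots> \<le> c * \<bar>\<epsilon> - \<epsilon>\<^sub>0\<bar> + \<bar>\<epsilon> - \<epsilon>\<^sub>0\<bar> * M"
        using c[OF u v] bound[of "u (Suc n)"] is_euler_solutionD(2)[OF u, of "Suc n"]
        by (intro norm_triangle_le add_mono) (auto intro!: mult_left_mono)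
      finally show "norm ((u n + (\<epsilon> - \<epsilon>\<^sub>0) *\<^sub>R F (u (Suc n))) - v n) \<le> \<dots>" .
    qed (use assms in simp)
    also have "\<dots> = (c + M) / (1 - \<epsilon>\<^sub>0 * L) * \<bar>\<epsilon> - \<epsilon>\<^sub>0\<bar>"
      by (simp add: algebra_simps add_divide_distrib)
    finally show "norm (u (Suc n) - v (Suc n)) \<le> (c + M) / (1 - \<epsilon>\<^sub>0 * L) * \<bar>\<epsilon> - \<epsilon>\<^sub>0\<bar>" .
  qed
qed

end

subsection \<open>Convergence of the attractors\<close>

text \<open>The strict bound leaves room below \<delta>, so a suitable point exists although the
  infimum need not be attained.\<close>

lemma hausdorff_semidist_lessD:
  assumes "hausdorff_semidist A B < ennreal \<delta>" "a \<in> A"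
  obtains b where "b \<in> B" "norm (a - b) < \<delta>"
proof -
  have "(INF b\<in>B. ennreal (norm (a - b))) \<le> hausdorff_semidist A B"
    unfolding hausdorff_semidist_def using assms(2) by (rule SUP_upper)
  then have "(INF b\<in>B. ennreal (norm (a - b))) < ennreal \<delta>"
    using assms(1) by (rule le_less_trans)
  then show ?thesis
    using that by (auto simp: INF_less_iff ennreal_less_iff)
qed

lemma hausdorff_semidist_leI:
  assumes "\<And>a. a \<in> A \<Longrightarrow> \<exists>b\<in>B. norm (a - b) \<le> \<delta>"
  shows "hausdorff_semidist A B \<le> ennreal \<delta>"
  unfolding hausdorff_semidist_def
proof (rule SUP_least)
  fix a assume "a \<in> A"
  then obtain b where "b \<in> B" "norm (a - b) \<le> \<delta>"
    using assms by blast
  then show "(INF b\<in>B. ennreal (norm (a - b))) \<le> ennreal \<delta>"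
    by (intro INF_lower2[of b]) (auto intro: ennreal_leI)
qed

lemma ennreal_tendsto_0I:
  fixes h :: "'a \<Rightarrow> ennreal"
  assumes "\<And>\<delta>. 0 < \<delta> \<Longrightarrow> \<forall>\<^sub>F x in G. h x \<le> ennreal \<delta>"
  shows "(h \<longlongrightarrow> 0) G"
proof (rule order_tendstoI)
  fix a :: ennreal assume "0 < a"
  then obtain b where b: "0 < b" "b < a"
    using dense by blast
  then obtain \<delta> where \<delta>: "b = ennreal \<delta>" "0 \<le> \<delta>"
    by (cases b) auto
  then have "0 < \<delta>"
    using b by (auto simp: less_le)
  from assms[OF this] show "\<forall>\<^sub>F x in G. h x < a"
    by eventually_elim (use b \<delta> in auto)
qed simp

text \<open>Up to 1/2 the product (1+2x)(1-x) is at least 1. This converts the growth factor of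
  \<open>n\<close> implicit steps into an exponential in the elapsed time.\<close>

lemma inverse_one_minus_le_exp:
  fixes x :: real
  assumes "0 \<le> x" "x \<le> 1 / 2"
  shows "1 / (1 - x) \<le> exp (2 * x)"
proof -
  have "1 \<le> (1 + 2 * x) * (1 - x)"
    using mult_nonneg_nonneg[of x "1 - 2 * x"] assms by (simp add: algebra_simps)
  also have "\<dots> \<le> exp (2 * x) * (1 - x)"
    using assms exp_ge_add_one_self[of "2 * x"] by (intro mult_right_mono) auto
  finally show ?thesis
    using assms by (simp add: pos_divide_le_eq)
qed

context inward_field
begin

text \<open>Invariance allows going back any number \<open>n\<close> of steps, and the starting
  point still lies in the attractor, hence in the ball.\<close>

lemma numerical_attractorD:
  assumes "is_numerical_attractor F r \<epsilon> B" "a \<in> B"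
  obtains y where "norm y \<le> r" "a = euler_flow F r \<epsilon> n y"
proof -
  have "a \<in> euler_flow F r \<epsilon> n ` B" "B \<subseteq> cball 0 r"
    using assms by (auto simp: is_numerical_attractor_def)
  then show ?thesis
    using that by auto
qed

lemma numerical_attractors_tendsto_global:
  assumes attract: "((\<lambda>t. hausdorff_semidist (flow F t ` cball 0 r) A) \<longlongrightarrow> 0) at_top"
    and "0 < es" and es: "es * M \<le> 1" "es * L < 1"
    and num: "\<And>\<epsilon>. \<epsilon> \<in> {0<..es} \<Longrightarrow> is_numerical_attractor F r \<epsilon> (A_num \<epsilon>)"
  shows "((\<lambda>\<epsilon>. hausdorff_semidist (A_num \<epsilon>) A) \<longlongrightarrow> 0) (at_right 0)"
proof (rule ennreal_tendsto_0I)
  fix \<delta> :: real assume "0 < \<delta>"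
  then have "\<forall>\<^sub>F t in at_top. hausdorff_semidist (flow F t ` cball 0 r) A < ennreal (\<delta> / 2)"
    by (intro order_tendstoD(2)[OF attract]) simp
  then obtain T' where T': "\<And>t. t \<ge> T' \<Longrightarrow>
      hausdorff_semidist (flow F t ` cball 0 r) A < ennreal (\<delta> / 2)"
    by (auto simp: eventually_at_top_linorder)
  define T where "T = max 0 T'"
  \<comment> \<open>Bounds the global error divided by \<epsilon>, for all grid times up to
    \<open>T + 1\<close>.\<close>
  define C where "C = M * exp (2 * L * (T + 1))"
  have "0 < C"
    using M_pos by (simp add: C_def)
  \<comment> \<open>The four entries ensure in turn: the numerical attractor exists, the grid time
    overshoots \<open>T\<close> by at most 1, \<open>\<epsilon> * L \<le> 1 / 2\<close>, and the
    global error is at most \<delta>/2.\<close>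
  define e where "e = Min {es, 1, 1 / (2 * (L + 1)), \<delta> / (2 * C)}"
  have "0 < e"
    using \<open>0 < es\<close> \<open>0 < \<delta>\<close> \<open>0 < C\<close> L_nonneg by (simp add: e_def)
  show "\<forall>\<^sub>F \<epsilon> in at_right 0. hausdorff_semidist (A_num \<epsilon>) A \<le> ennreal \<delta>"
  proof (rule eventually_at_rightI[OF _ \<open>0 < e\<close>], rule hausdorff_semidist_leI)
    fix \<epsilon> a assume \<epsilon>: "\<epsilon> \<in> {0<..<e}" and a: "a \<in> A_num \<epsilon>"
    have \<epsilon>_less: "0 < \<epsilon>" "\<epsilon> < es" "\<epsilon> < 1" "\<epsilon> < 1 / (2 * (L + 1))" "\<epsilon> < \<delta> / (2 * C)"
      using \<epsilon> by (auto simp: e_def)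
    have \<epsilon>_C: "\<epsilon> * C \<le> \<delta> / 2"
      using \<epsilon>_less(5) \<open>0 < C\<close> by (simp add: field_simps)
    have \<epsilon>_L: "\<epsilon> * L \<le> 1 / 2" "\<epsilon> * L < 1"
      using \<epsilon>_less(1,4) L_nonneg by (simp_all add: field_simps)
    have \<epsilon>_M: "\<epsilon> * M \<le> 1"
      using order_trans[OF mult_right_mono[of \<epsilon> es M] es(1)] \<epsilon>_less(2) M_pos by simp
    \<comment> \<open>The first grid index whose time reaches \<open>T\<close>; rounding up costs at
      most one step.\<close>
    define n where "n = nat \<lceil>T / \<epsilon>\<rceil>"
    have "T / \<epsilon> \<le> real n" "real n \<le> T / \<epsilon> + 1"
      using \<epsilon>_less(1) by (auto simp: n_def T_def)
    then have n: "T \<le> real n * \<epsilon>" "real n * \<epsilon> \<le> T + 1"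
      using \<epsilon>_less(1,3) by (auto simp: field_simps)
    obtain y where y: "norm y \<le> r" "a = euler_flow F r \<epsilon> n y"
      using numerical_attractorD[OF num a] \<epsilon>_less by auto
    define z where "z = flow F (real n * \<epsilon>) y"
    have "norm (a - z) \<le> \<epsilon> * M * ((1 / (1 - \<epsilon> * L)) ^ n - 1)"
      unfolding y(2) z_def
      by (rule euler_global_error[OF is_solution_flow[OF y(1)] is_euler_solution_euler_flow])
        (use \<epsilon>_less \<epsilon>_L \<epsilon>_M y in auto)
    also have "\<dots> \<le> \<epsilon> * M * exp (2 * L * (T + 1))"
    proof (intro mult_left_mono)
      have "(1 / (1 - \<epsilon> * L)) ^ n \<le> exp (2 * (\<epsilon> * L)) ^ n"
        using \<epsilon>_less \<epsilon>_L L_nonneg by (intro power_mono inverse_one_minus_le_exp) auto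
      also have "\<dots> = exp (2 * L * (real n * \<epsilon>))"
        by (simp add: mult_ac flip: exp_of_nat_mult)
      also have "\<dots> \<le> exp (2 * L * (T + 1))"
        using n(2) L_nonneg by (simp add: mult_left_mono)
      finally show "(1 / (1 - \<epsilon> * L)) ^ n - 1 \<le> exp (2 * L * (T + 1))"
        by simp
    qed (use \<epsilon>_less M_pos in auto)
    finally have az: "norm (a - z) \<le> \<delta> / 2"
      using \<epsilon>_C by (simp add: C_def)
    have "hausdorff_semidist (flow F (real n * \<epsilon>) ` cball 0 r) A < ennreal (\<delta> / 2)"
      using n(1) by (intro T') (simp add: T_def)
    moreover have "z \<in> flow F (real n * \<epsilon>) ` cball 0 r"
      using y(1) by (simp add: z_def)
    ultimately obtain b where "b \<in> A" "norm (z - b) < \<delta> / 2"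
      by (rule hausdorff_semidist_lessD)
    then have "norm (a - b) \<le> \<delta>"
      using norm_triangle_ineq[of "a - z" "z - b"] az by simp
    then show "\<exists>b\<in>A. norm (a - b) \<le> \<delta>"
      using \<open>b \<in> A\<close> by blast
  qed
qed

lemma numerical_attractors_upper_semicontinuous:
  assumes \<epsilon>\<^sub>0: "\<epsilon>\<^sub>0 \<in> {0<..es}" and es: "es * M \<le> 1" "es * L < 1"
    and num: "\<And>\<epsilon>. \<epsilon> \<in> {0<..es} \<Longrightarrow> is_numerical_attractor F r \<epsilon> (A_num \<epsilon>)"
  shows "((\<lambda>\<epsilon>. hausdorff_semidist (A_num \<epsilon>) (A_num \<epsilon>\<^sub>0)) \<longlongrightarrow> 0) (at \<epsilon>\<^sub>0 within {0<..es})"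
proof (rule ennreal_tendsto_0I)
  have solution: "is_euler_solution F r \<epsilon> y (\<lambda>n. euler_flow F r \<epsilon> n y)"
    if "\<epsilon> \<in> {0<..es}" "norm y \<le> r" for \<epsilon> y
    using that es M_pos L_nonneg order_trans[OF mult_right_mono[of \<epsilon> es M] es(1)] mult_right_mono[of \<epsilon> es L]
    by (intro is_euler_solution_euler_flow) auto
  fix \<delta> :: real assume "0 < \<delta>"
  have "(\<lambda>n. hausdorff_semidist (euler_flow F r \<epsilon>\<^sub>0 n ` cball 0 r) (A_num \<epsilon>\<^sub>0)) \<longlonglongrightarrow> 0"
    using num[OF \<epsilon>\<^sub>0] by (simp add: is_numerical_attractor_def)
  then have "\<forall>\<^sub>F n in sequentially.
      hausdorff_semidist (euler_flow F r \<epsilon>\<^sub>0 n ` cball 0 r) (A_num \<epsilon>\<^sub>0) < ennreal (\<delta> / 2)"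
    using \<open>0 < \<delta>\<close> by (intro order_tendstoD(2)) auto
  \<comment> \<open>The index is fixed before \<epsilon> varies, since the constant \<open>c\<close>
    obtained next depends on it.\<close>
  then obtain n where n:
      "hausdorff_semidist (euler_flow F r \<epsilon>\<^sub>0 n ` cball 0 r) (A_num \<epsilon>\<^sub>0) < ennreal (\<delta> / 2)"
    by (auto simp: eventually_sequentially)
  have "\<epsilon>\<^sub>0 * L < 1"
    using \<epsilon>\<^sub>0 es L_nonneg mult_right_mono[of \<epsilon>\<^sub>0 es L] by auto
  then obtain c where c: "\<And>\<epsilon> y u v. is_euler_solution F r \<epsilon> y u \<Longrightarrow>
      is_euler_solution F r \<epsilon>\<^sub>0 y v \<Longrightarrow> norm (u n - v n) \<le> c * \<bar>\<epsilon> - \<epsilon>\<^sub>0\<bar>"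
    using euler_step_size_continuity[of \<epsilon>\<^sub>0 n] \<epsilon>\<^sub>0 by auto
  have "((\<lambda>\<epsilon>. c * \<bar>\<epsilon> - \<epsilon>\<^sub>0\<bar>) \<longlongrightarrow> 0) (at \<epsilon>\<^sub>0 within {0<..es})"
    by (auto intro!: tendsto_eq_intros)
  then have "\<forall>\<^sub>F \<epsilon> in at \<epsilon>\<^sub>0 within {0<..es}. c * \<bar>\<epsilon> - \<epsilon>\<^sub>0\<bar> < \<delta> / 2"
    using \<open>0 < \<delta>\<close> by (intro order_tendstoD(2)) auto
  moreover have "\<forall>\<^sub>F \<epsilon> in at \<epsilon>\<^sub>0 within {0<..es}. \<epsilon> \<in> {0<..es}"
    by (simp add: eventually_at_filter)
  ultimately show "\<forall>\<^sub>F \<epsilon> in at \<epsilon>\<^sub>0 within {0<..es}.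
      hausdorff_semidist (A_num \<epsilon>) (A_num \<epsilon>\<^sub>0) \<le> ennreal \<delta>"
  proof eventually_elim
    case (elim \<epsilon>)
    show ?case
    proof (rule hausdorff_semidist_leI)
      fix a assume a: "a \<in> A_num \<epsilon>"
      obtain y where y: "norm y \<le> r" "a = euler_flow F r \<epsilon> n y"
        using numerical_attractorD[OF num[OF elim(2)] a] by auto
      define z where "z = euler_flow F r \<epsilon>\<^sub>0 n y"
      have az: "norm (a - z) \<le> \<delta> / 2"
        using c[OF solution[OF elim(2) y(1)] solution[OF \<epsilon>\<^sub>0 y(1)]] elim(1)
        unfolding y(2) z_def by linarith
      have "z \<in> euler_flow F r \<epsilon>\<^sub>0 n ` cball 0 r"
        using y(1) by (simp add: z_def)
      with n obtain b where "b \<in> A_num \<epsilon>\<^sub>0" "norm (z - b) < \<delta> / 2"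
        by (rule hausdorff_semidist_lessD)
      then have "norm (a - b) \<le> \<delta>"
        using norm_triangle_ineq[of "a - z" "z - b"] az by simp
      then show "\<exists>b\<in>A_num \<epsilon>\<^sub>0. norm (a - b) \<le> \<delta>"
        using \<open>b \<in> A_num \<epsilon>\<^sub>0\<close> by blast
    qed
  qed
qed

end

section \<open>Application to the lattice field\<close>

lemma inward_field_vector_field:
  fixes f :: ell2
  assumes "\<alpha> > 0" "\<beta> > 0" "\<nu> > 0" "lam > 0" "0 < \<gamma>" and lam: "lam > lambda_star \<alpha> \<beta> \<nu> \<gamma>"
  defines "r \<equiv> r_star \<alpha> \<beta> \<nu> lam \<gamma> f"
  shows "inward_field (vector_field \<alpha> \<beta> \<nu> lam \<gamma> f) r
    (M_const \<alpha> \<beta> \<nu> lam \<gamma> f (r + 1)) (L_const \<alpha> \<beta> \<nu> lam \<gamma> (r + 1))"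
proof
  define d where "d = lam - lambda_star \<alpha> \<beta> \<nu> \<gamma>"
  have "0 < d"
    using lam by (simp add: d_def)
  have r: "r = 1 + norm f / d"
    by (simp add: r_def r_star_def d_def)
  then show "0 \<le> r"
    using \<open>0 < d\<close> by simp
  then show "0 < M_const \<alpha> \<beta> \<nu> lam \<gamma> f (r + 1)"
    using assms unfolding M_const_def by (intro add_pos_nonneg) auto
  show "0 \<le> L_const \<alpha> \<beta> \<nu> lam \<gamma> (r + 1)"
    using assms \<open>0 \<le> r\<close> unfolding L_const_def
    by (intro add_nonneg_nonneg mult_nonneg_nonneg real_sqrt_ge_zero) auto
  show "norm (vector_field \<alpha> \<beta> \<nu> lam \<gamma> f u) \<le> M_const \<alpha> \<beta> \<nu> lam \<gamma> f (r + 1)"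
    if "norm u \<le> r + 1" for u
    using assms that by (intro norm_vector_field_le) auto
  show "norm (vector_field \<alpha> \<beta> \<nu> lam \<gamma> f u - vector_field \<alpha> \<beta> \<nu> lam \<gamma> f v)
      \<le> L_const \<alpha> \<beta> \<nu> lam \<gamma> (r + 1) * norm (u - v)"
    if "norm u \<le> r + 1" "norm v \<le> r + 1" for u v
    using assms that by (intro vector_field_lipschitz) auto
  show "vector_field \<alpha> \<beta> \<nu> lam \<gamma> f u \<bullet> u \<le> 0" if "r \<le> norm u" for u
  proof -
    \<comment> \<open>The radius \<open>r_star\<close> is such that \<open>d * r\<close> equals
      \<open>d + norm f\<close>; beyond it the dissipation outweighs the forcing.\<close>
    have "norm f \<le> d * r"
      using \<open>0 < d\<close> by (simp add: r algebra_simps)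
    also have "\<dots> \<le> d * norm u"
      using \<open>0 < d\<close> that by simp
    finally have "norm f * norm u \<le> d * (norm u)\<^sup>2"
      using mult_right_mono[of "norm f" "d * norm u" "norm u"] by (simp add: power2_eq_square)
    then show ?thesis
      using inner_vector_field_le[of \<alpha> \<beta> \<nu> \<gamma> lam f u] assms by (simp add: d_def)
  qed
qed

theorem theorem3p2:
  fixes \<alpha> \<beta> \<nu> lam \<gamma> :: real and f :: ell2
    and A :: "ell2 set" and A_num :: "real \<Rightarrow> ell2 set"
  defines "F \<equiv> vector_field \<alpha> \<beta> \<nu> lam \<gamma> f"
    and "rs \<equiv> r_star \<alpha> \<beta> \<nu> lam \<gamma> f"
    and "es \<equiv> eps_star \<alpha> \<beta> \<nu> lam \<gamma> f"
  assumes "\<alpha> > 0" "\<beta> > 0" "\<nu> > 0" "lam > 0" "0 < \<gamma>" "\<gamma> < 1"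
    and "lam > lambda_star \<alpha> \<beta> \<nu> \<gamma>"
    and "is_global_attractor F A"
    and "\<And>\<epsilon>. \<epsilon> \<in> {0<..es} \<Longrightarrow> is_numerical_attractor F rs \<epsilon> (A_num \<epsilon>)"
  shows "((\<lambda>\<epsilon>. hausdorff_semidist (A_num \<epsilon>) A) \<longlongrightarrow> 0) (at_right 0)
    \<and> (\<forall>\<epsilon>\<^sub>0\<in>{0<..es}.
          ((\<lambda>\<epsilon>. hausdorff_semidist (A_num \<epsilon>) (A_num \<epsilon>\<^sub>0)) \<longlongrightarrow> 0) (at \<epsilon>\<^sub>0 within {0<..es}))"
proof -
  define M where "M = M_const \<alpha> \<beta> \<nu> lam \<gamma> f (rs + 1)"
  define L where "L = L_const \<alpha> \<beta> \<nu> lam \<gamma> (rs + 1)"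
  interpret inward_field F rs M L
    unfolding F_def rs_def M_def L_def using assms by (intro inward_field_vector_field) auto
  have es_eq: "es = min (1 / M) (1 / (1 + L))"
    by (simp add: es_def eps_star_def M_def L_def rs_def)
  have es: "0 < es" "es * M \<le> 1" "es * (1 + L) \<le> 1"
    using M_pos L_nonneg by (auto simp: es_eq min_def field_simps)
  \<comment> \<open>The summand 1 in the second bound of \<open>eps_star\<close> makes this strict,
    as \<open>es\<close> is positive.\<close>
  then have "es * L < 1"
    by (simp add: algebra_simps)
  \<comment> \<open>The global attractor is known to attract balls of positive radius, and the ball
    of radius \<open>rs\<close> has to be one of them.\<close>
  have "0 < rs"
    using assms by (auto simp: rs_def r_star_def intro!: add_pos_nonneg)
  then have "((\<lambda>t. hausdorff_semidist (flow F t ` cball 0 rs) A) \<longlongrightarrow> 0) at_top"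
    using \<open>is_global_attractor F A\<close> by (simp add: is_global_attractor_def)
  then show ?thesis
    using numerical_attractors_tendsto_global numerical_attractors_upper_semicontinuous
      es \<open>es * L < 1\<close> assms(12) by blast
qed

end
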